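(* The $28$ bitangents to the Klein quartic curve intersect along $252$ double and $21$ quadruple points (and at no other points).
   Context: Work over $\mathbb{C}$. The Klein quartic is the smooth plane curve in $\mathbb{P}^2_{\mathbb{C}}$ given by $x^4 + y^4 + z^4 + \lambda(x^2y^2 + x^2z^2 + y^2z^2)=0$, where $\lambda$ is either root of $\lambda^2+3\lambda+18=0$. A bitangent of a smooth plane quartic is a line tangent to the curve at two points, which are allowed to coincide, i.e. the line cuts out a divisor $2P+2P'$ on the curve, with $P=P'$ allowed. A double (respectively quadruple) point of a line arrangement is a point lying on exactly two (respectively exactly four) of the lines. *)

theory Defs
  imports "HOL-Analysis.Analysis" "HOL-Computational_Algebra.Polynomial"
begin

text \<open>The points and lines of the complex projective plane are the linear subspaces of
  \<^typ>\<open>complex^3\<close> of (complex) dimension 1 and 2; the point \<open>P\<close> lies on the line \<open>L\<close> iff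
  \<open>P \<subseteq> L\<close>.\<close>

definition proj_points :: "(complex^3) set set" where
  "proj_points = {P. vec.subspace P \<and> vec.dim P = 1}"

definition proj_lines :: "(complex^3) set set" where
  "proj_lines = {L. vec.subspace L \<and> vec.dim L = 2}"

text \<open>A plane curve is given by its equation, a homogeneous polynomial function
  \<open>F\<close> on \<^typ>\<open>complex^3\<close>.\<close>

definition klein_form :: "complex \<Rightarrow> complex^3 \<Rightarrow> complex" where
  "klein_form l v =
     (v$1)^4 + (v$2)^4 + (v$3)^4 +
     l * ((v$1)^2 * (v$2)^2 + (v$1)^2 * (v$3)^2 + (v$2)^2 * (v$3)^2)"

text \<open>The multiplicity at a point \<open>P\<close> of \<open>L\<close> of the divisor that \<open>L\<close> cuts out on the curve
  \<open>F = 0\<close>: if \<open>p\<close> spans \<open>P\<close> and \<open>p, q\<close> span \<open>L\<close>, then \<open>t \<mapsto> p + t q\<close> parametrizes \<open>L\<close> near \<open>P\<close>,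
  and the multiplicity is the vanishing order at \<open>t = 0\<close> of the restriction of \<open>F\<close>. For
  homogeneous \<open>F\<close> it does not depend on \<open>p\<close> and \<open>q\<close>. It is meaningful only if \<open>P \<subseteq> L\<close> and
  \<open>F\<close> does not vanish identically on \<open>L\<close>.\<close>

definition intersection_mult ::
    "(complex^3 \<Rightarrow> complex) \<Rightarrow> (complex^3) set \<Rightarrow> (complex^3) set \<Rightarrow> nat" where
  "intersection_mult F L P =
     (THE m. \<exists>p q r. P = vec.span {p} \<and> L = vec.span {p, q} \<and>
        (\<forall>t. poly r t = F (p + t *s q)) \<and> m = order 0 r)"

text \<open>The line \<open>L\<close> cuts out the divisor \<open>2P + 2P'\<close>, where \<open>P = P'\<close> is allowed.\<close>

definition bitangent :: "(complex^3 \<Rightarrow> complex) \<Rightarrow> (complex^3) set \<Rightarrow> bool" where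
  "bitangent F L \<longleftrightarrow>
     L \<in> proj_lines \<and> (\<exists>v\<in>L. F v \<noteq> 0) \<and>
     (\<exists>P\<in>proj_points. \<exists>P'\<in>proj_points. P \<subseteq> L \<and> P' \<subseteq> L \<and>
        (\<forall>Q\<in>proj_points. Q \<subseteq> L \<longrightarrow>
           intersection_mult F L Q = 2 * of_bool (Q = P) + 2 * of_bool (Q = P')))"

definition bitangents :: "(complex^3 \<Rightarrow> complex) \<Rightarrow> (complex^3) set set" where
  "bitangents F = {L. bitangent F L}"

text \<open>The points lying on exactly \<open>k\<close> lines of \<open>\<A>\<close>: double points for \<open>k = 2\<close>, quadruple
  points for \<open>k = 4\<close>.\<close>

definition arrangement_points :: "(complex^3) set set \<Rightarrow> nat \<Rightarrow> (complex^3) set set" where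
  "arrangement_points \<A> k = {P \<in> proj_points. card {L \<in> \<A>. P \<subseteq> L} = k}"

definition intersection_points :: "(complex^3) set set \<Rightarrow> (complex^3) set set" where
  "intersection_points \<A> =
     {P \<in> proj_points. \<exists>L\<in>\<A>. \<exists>L'\<in>\<A>. L \<noteq> L' \<and> P \<subseteq> L \<and> P \<subseteq> L'}"

end

theory Submission
  imports Defs
begin

text \<open>A line is a bitangent iff the quartic form restricts to it as the nonzero square of a binary
  quadratic form. For \<open>z = u x + v y\<close> this square condition forces \<open>u v = 0\<close>, \<open>u\<^sup>2 = v\<^sup>2\<close> or
  \<open>u\<^sup>2 + v\<^sup>2 = - \<lambda>\<close>, and each case is solved by radicals. With \<open>\<lambda> = 3 \<alpha>\<close>, \<open>\<alpha>\<^sup>2 + \<alpha> + 2 = 0\<close>, all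
  solutions have coordinates in \<open>\<int>[\<alpha>]\<close>: up to sign changes and permutations of the coordinates
  they are \<open>(1, 1, 1)\<close>, \<open>(0, 1, \<alpha>)\<close> and \<open>(1, 1, \<alpha> - 1)\<close>. A point on at least two of the lines is
  determined by the set of lines through it, and these sets are found by exact integer
  arithmetic on the cross products of pairs of lines.\<close>

section \<open>Lines, points and multiplicities\<close>

text \<open>Bitangency is defined by vanishing orders, while a classification needs equations in the
  coefficients of a line. Squares are the bridge because they survive a change of basis: a line can
  be tested in any basis, with its contact points unknown, and distinct and coinciding contact
  points need no separate equations.

  The substitution \<open>\<lambda> = 3 \<alpha>\<close> is chosen so that the radicals resolve:
  \<open>- \<lambda> - 1\<close> becomes \<open>(\<alpha> - 1)^2\<close>, and the equation left for
  \<open>u = 0\<close> has the solutions \<open>v = \<plusminus>\<alpha>\<close> and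
  \<open>v = \<plusminus>1 / \<alpha>\<close>. Both roots \<open>\<lambda>\<close> are thereby
  treated alike. The three shapes of coordinates contribute 4 + 12 + 12 = 28 lines.

  Counting meets two obstacles: complex numbers cannot be compared by evaluation, and a projective
  point has no canonical vector. Pairs of integers remove the one, lists of lines in a fixed order
  the other. The numbers fit together: the 378 pairs of lines are 252 + 6 * 21.\<close>

lemma in_span2: "v \<in> vec.span {p, q} \<longleftrightarrow> (\<exists>x y. v = x *s p + y *s (q :: complex^'n))"
proof -
  have "v \<in> vec.span {p, q} \<longleftrightarrow> (\<exists>x y. v - x *s p = y *s q)"
    by (simp add: vec.span_breakdown_eq vec.span_singleton image_iff)
  then show ?thesis by (metis add_diff_cancel_left' diff_add_cancel add.commute)
qed

lemma in_span1: "v \<in> vec.span {p} \<longleftrightarrow> (\<exists>x. v = x *s (p :: complex^'n))"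
  by (auto simp: vec.span_singleton)

text \<open>Dimension 2 of the set \<open>{p, q}\<close> serves as linear independence of the pair:
  \<open>vec.independent {p, q}\<close> would also hold for \<open>p = q \<noteq> 0\<close>, where
  the set collapses to a singleton.\<close>

lemma dim_pair_eq_2_iff:
  "vec.dim {p, q} = 2 \<longleftrightarrow> (\<forall>x y. x *s p + y *s (q :: complex^'n) = 0 \<longrightarrow> x = 0 \<and> y = 0)"
proof
  assume d: "vec.dim {p, q} = 2"
  then have q: "q \<noteq> 0" and p: "p \<notin> vec.span {q}"
    by (auto simp: vec.dim_insert split: if_splits)
  show "\<forall>x y. x *s p + y *s q = 0 \<longrightarrow> x = 0 \<and> y = 0"
  proof (intro allI impI)
    fix x y assume *: "x *s p + y *s q = 0"
    have "x = 0"
    proof (rule ccontr)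
      assume x: "x \<noteq> 0"
      have "p = inverse x *s (x *s p)" using x by simp
      also have "x *s p = (- y) *s q" using * by (simp add: add_eq_0_iff2)
      finally have "p = (- y / x) *s q" by (simp add: field_simps)
      then show False using p in_span1 by blast
    qed
    then show "x = 0 \<and> y = 0" using * q by simp
  qed
next
  assume ind: "\<forall>x y. x *s p + y *s q = 0 \<longrightarrow> x = 0 \<and> y = 0"
  have "q \<noteq> 0" using ind[rule_format, of 0 1] by auto
  moreover have "p \<notin> vec.span {q}"
  proof
    assume "p \<in> vec.span {q}"
    then obtain k where "p = k *s q" using in_span1 by blast
    then show False using ind[rule_format, of 1 "-k"] by simp
  qed
  ultimately show "vec.dim {p, q} = 2" by (simp add: vec.dim_insert)
qed

lemma proj_lines_iff: "L \<in> proj_lines \<longleftrightarrow> (\<exists>p q. vec.dim {p, q} = 2 \<and> L = vec.span {p, q})"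
proof
  assume "L \<in> proj_lines"
  then have L: "vec.subspace L" "vec.dim L = 2" by (auto simp: proj_lines_def)
  obtain B where B: "B \<subseteq> L" "vec.independent B" "L \<subseteq> vec.span B" "card B = vec.dim L"
    using vec.basis_exists by blast
  then obtain p q where "B = {p, q}" using L by (auto simp: card_2_iff)
  moreover have "L = vec.span B" using B L by (simp add: vec.span_minimal subset_antisym)
  ultimately show "\<exists>p q. vec.dim {p, q} = 2 \<and> L = vec.span {p, q}"
    using L by (metis vec.dim_span)
qed (auto simp: proj_lines_def)

lemma proj_points_iff: "P \<in> proj_points \<longleftrightarrow> (\<exists>p. p \<noteq> 0 \<and> P = vec.span {p})"
proof
  assume "P \<in> proj_points"
  then have P: "vec.subspace P" "vec.dim P = 1" by (auto simp: proj_points_def)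
  obtain B where B: "B \<subseteq> P" "vec.independent B" "P \<subseteq> vec.span B" "card B = vec.dim P"
    using vec.basis_exists by blast
  then obtain p where "B = {p}" using P by (auto simp: card_1_singleton_iff)
  moreover have "P = vec.span B" using B P by (simp add: vec.span_minimal subset_antisym)
  ultimately show "\<exists>p. p \<noteq> 0 \<and> P = vec.span {p}"
    using B(2) by auto
qed (auto simp: proj_points_def vec.dim_insert)

lemma span_singleton_subset_iff: "vec.subspace L \<Longrightarrow> vec.span {p} \<subseteq> L \<longleftrightarrow> p \<in> L"
  using vec.span_base[of p "{p}"] vec.span_minimal[of "{p}" L] by auto

text \<open>Coefficients are indexed by the power of \<open>y\<close>: the point
  \<open>vec.span {p}\<close> of the line \<open>x p + y q\<close> is \<open>y = 0\<close>, so the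
  multiplicity there is the least index with a nonzero coefficient.\<close>

definition binary_form :: "nat \<Rightarrow> (nat \<Rightarrow> complex) \<Rightarrow> complex \<Rightarrow> complex \<Rightarrow> complex" where
  "binary_form n g x y = (\<Sum>i\<le>n. g i * x ^ (n - i) * y ^ i)"

text \<open>The definite description is legitimate because any other choice is
  \<open>p' = c p\<close>, \<open>q' = d p + e q\<close> with \<open>c\<close> and \<open>e\<close>
  nonzero. The restriction becomes the form at \<open>(c + d t, e t)\<close>, whose remaining terms
  all contain \<open>t^m\<close>, and only the term with index \<open>m\<close> contributes at that
  order.\<close>

lemma intersection_mult_eq:
  assumes ind: "vec.dim {p, q} = 2"
    and F: "\<And>x y. F (x *s p + y *s q) = binary_form n g x y"
    and m: "m \<le> n" "g m \<noteq> 0" "\<And>i. i < m \<Longrightarrow> g i = 0"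
  shows "intersection_mult F (vec.span {p, q}) (vec.span {p}) = m"
proof -
  note ind' = ind[unfolded dim_pair_eq_2_iff, rule_format]
  have order_eq: "order 0 r = m"
    if c: "c \<noteq> 0" and e: "e \<noteq> 0" and r: "\<And>t. poly r t = binary_form n g (c + d * t) (e * t)"
    for c d e r
  proof -
    \<comment> \<open>The quotient of \<open>r\<close> by \<open>t^m\<close>; its value at 0 is
      \<open>g m * e^m * c^(n - m)\<close>.\<close>
    define h where "h = (\<Sum>i\<in>{m..n}. smult (g i * e ^ i) ([:c, d:] ^ (n - i) * [:0, 1:] ^ (i - m)))"
    have "r = [:- 0, 1:] ^ m * h"
    proof (rule poly_ext)
      fix t
      have "poly r t = (\<Sum>i\<in>{m..n}. g i * (c + d * t) ^ (n - i) * (e * t) ^ i)"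
        unfolding r binary_form_def by (rule sum.mono_neutral_right) (auto simp: m(3) not_le)
      also have "\<dots> = (\<Sum>i\<in>{m..n}. t ^ m * (g i * e ^ i * ((c + d * t) ^ (n - i) * t ^ (i - m))))"
        by (rule sum.cong) (auto simp: power_mult_distrib simp flip: power_add)
      also have "\<dots> = poly ([:- 0, 1:] ^ m * h) t"
        by (simp add: h_def poly_sum sum_distrib_left mult_ac)
      finally show "poly r t = poly ([:- 0, 1:] ^ m * h) t" .
    qed
    moreover have "poly h 0 = (\<Sum>i\<in>{m}. g i * e ^ i * (c ^ (n - i) * 0 ^ (i - m)))"
      unfolding h_def poly_sum using m(1) by (intro sum.mono_neutral_cong_right) auto
    then have h: "poly h 0 \<noteq> 0" using c e m by simp
    moreover from h have "h \<noteq> 0" by auto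
    ultimately show ?thesis
      using order_mult[of "[:- 0, 1:] ^ m" h 0] order_power_n_n[of 0 m] order_0I[OF h] by simp
  qed
  have "(\<exists>p' q' r. vec.span {p} = vec.span {p'} \<and> vec.span {p, q} = vec.span {p', q'} \<and>
        (\<forall>t. poly r t = F (p' + t *s q')) \<and> m' = order 0 r) \<longleftrightarrow> m' = m" for m'
  proof
    assume "\<exists>p' q' r. vec.span {p} = vec.span {p'} \<and> vec.span {p, q} = vec.span {p', q'} \<and>
        (\<forall>t. poly r t = F (p' + t *s q')) \<and> m' = order 0 r"
    then obtain p' q' r where P: "vec.span {p} = vec.span {p'}"
      and L: "vec.span {p, q} = vec.span {p', q'}"
      and r: "\<And>t. poly r t = F (p' + t *s q')" and m': "m' = order 0 r" by blast
    have "p' \<in> vec.span {p}" unfolding P by (simp add: vec.span_base)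
    then obtain c where c: "p' = c *s p" using in_span1 by blast
    have "q' \<in> vec.span {p, q}" unfolding L by (simp add: vec.span_base)
    then obtain d e where de: "q' = d *s p + e *s q" using in_span2 by blast
    have "p \<in> vec.span {p'}" unfolding P[symmetric] by (simp add: vec.span_base)
    then obtain x where "p = x *s p'" using in_span1 by blast
    then have "c \<noteq> 0" using ind'[of 1 0] c by auto
    moreover have "q \<in> vec.span {p', q'}" unfolding L[symmetric] by (simp add: vec.span_base)
    then obtain x y where "q = x *s p' + y *s q'" using in_span2 by blast
    \<comment> \<open>Independence turns this into \<open>y * e = 1\<close>.\<close>
    then have "(x * c + y * d) *s p + (y * e - 1) *s q = 0"
      unfolding c de by (simp add: vec_eq_iff algebra_simps)
    then have "e \<noteq> 0" using ind' by fastforce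
    moreover have "poly r t = binary_form n g (c + d * t) (e * t)" for t
    proof -
      have "p' + t *s q' = (c + d * t) *s p + (e * t) *s q"
        unfolding c de by (simp add: vec_eq_iff algebra_simps)
      then show ?thesis by (simp only: r F)
    qed
    ultimately show "m' = m" using m' order_eq by blast
  next
    assume "m' = m"
    define r where "r = (\<Sum>i\<le>n. monom (g i) i)"
    have r: "poly r t = binary_form n g 1 t" for t
      by (simp add: r_def poly_sum poly_monom binary_form_def)
    have "order 0 r = m" by (rule order_eq[of 1 1 r 0]) (simp_all add: r)
    moreover have "poly r t = F (p + t *s q)" for t using F[of 1 t] r by simp
    ultimately show "\<exists>p' q' r. vec.span {p} = vec.span {p'} \<and> vec.span {p, q} = vec.span {p', q'} \<and>
        (\<forall>t. poly r t = F (p' + t *s q')) \<and> m' = order 0 r"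
      using \<open>m' = m\<close> by metis
  qed
  then show ?thesis unfolding intersection_mult_def by simp
qed

section \<open>Bitangents and squares\<close>

lemma proj_line_eq_span:
  assumes "L \<in> proj_lines" "p \<in> L" "q \<in> L" "vec.dim {p, q} = 2"
  shows "L = vec.span {p, q}"
proof -
  have "vec.span {p, q} \<subseteq> L" "vec.dim L = 2" "vec.subspace L"
    using assms vec.span_minimal[of "{p, q}" L] by (simp_all add: proj_lines_def)
  then show ?thesis
    using vec.subspace_dim_equal[of "vec.span {p, q}" L] assms(4) by (simp add: vec.subspace_span)
qed

lemma proj_line_obtain_basis:
  assumes "L \<in> proj_lines" "p \<in> L" "p \<noteq> 0"
  obtains q where "vec.dim {p, q} = 2" "L = vec.span {p, q}"
proof -
  have L: "vec.dim L = 2" using assms by (simp add: proj_lines_def)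
  have "\<not> L \<subseteq> vec.span {p}"
  proof
    assume "L \<subseteq> vec.span {p}"
    then have "vec.dim L \<le> vec.dim {p}" using vec.dim_mono by blast
    then show False using L by (auto split: if_splits)
  qed
  then obtain q where q: "q \<in> L" "q \<notin> vec.span {p}" by blast
  then have "vec.dim {q, p} = 2" using assms(3) by (simp add: vec.dim_insert)
  then have d: "vec.dim {p, q} = 2" by (simp add: insert_commute)
  show thesis using that[OF d proj_line_eq_span[OF assms(1,2) q(1) d]] .
qed

text \<open>Reads coefficients off a known multiplicity. A point of \<open>L\<close> off the curve
  guarantees some nonzero coefficient, hence a first one, and its index is the multiplicity.\<close>

lemma intersection_mult_least:
  assumes "vec.dim {p, q} = 2" "L = vec.span {p, q}"
    and F: "\<And>x y. F (x *s p + y *s q) = binary_form n g x y"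
    and "v \<in> L" "F v \<noteq> 0"
  shows "g (intersection_mult F L (vec.span {p})) \<noteq> 0 \<and>
    (\<forall>i < intersection_mult F L (vec.span {p}). g i = 0)"
proof -
  obtain x y where "v = x *s p + y *s q" using assms(2,4) in_span2 by blast
  then have "binary_form n g x y \<noteq> 0" using assms(5) F by simp
  then have "\<exists>i. i \<le> n \<and> g i \<noteq> 0" unfolding binary_form_def
    by (metis (no_types, lifting) atMost_iff mult_zero_left sum.neutral)
  then obtain m where m: "m \<le> n" "g m \<noteq> 0" "\<And>i. i < m \<Longrightarrow> g i = 0"
    using exists_least_iff[of "\<lambda>i. i \<le> n \<and> g i \<noteq> 0"] by (metis less_le_trans less_imp_le)
  have "intersection_mult F L (vec.span {p}) = m"
    unfolding assms(2) by (rule intersection_mult_eq[OF assms(1) F m])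
  then show ?thesis using m by simp
qed

lemma span_singleton_eq_iff:
  assumes "p \<noteq> 0" "q \<noteq> 0"
  shows "vec.span {p} = vec.span {q} \<longleftrightarrow> vec.dim {p, q} \<noteq> 2"
proof
  assume "vec.span {p} = vec.span {q}"
  then have "p \<in> vec.span {q}" using vec.span_base[of p "{p}"] by simp
  then show "vec.dim {p, q} \<noteq> 2" by (simp add: vec.dim_insert)
next
  assume "vec.dim {p, q} \<noteq> 2"
  then have "p \<in> vec.span {q}" using assms by (auto simp: vec.dim_insert split: if_splits)
  then have "vec.span {p} \<subseteq> vec.span {q}" by (simp add: vec.span_minimal)
  then show "vec.span {p} = vec.span {q}"
    using vec.subspace_dim_equal[of "vec.span {p}" "vec.span {q}"] assms by simp
qed

lemma binary_form_4:
  "binary_form 4 g x y = g 0 * x^4 + g 1 * x^3 * y + g 2 * x^2 * y^2 + g 3 * x * y^3 + g 4 * y^4"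
proof -
  have "{..4} = {0, 1, 2, 3, 4 :: nat}" by auto
  then show ?thesis by (simp add: binary_form_def)
qed

lemma dim_pair_nonzero:
  assumes "vec.dim {p, q :: complex^'n} = 2" shows "p \<noteq> 0" "q \<noteq> 0"
  using assms[unfolded dim_pair_eq_2_iff, rule_format, of 1 0]
    assms[unfolded dim_pair_eq_2_iff, rule_format, of 0 1] by auto

text \<open>Bases adapted to the contact points: for independent \<open>p\<close> and
  \<open>q\<close>, the first form vanishes doubly at each of the two points they span, the second
  to order 4 at \<open>p\<close> alone, with \<open>q\<close> any other point of the line.\<close>

definition bitangent_basis :: "(complex^3 \<Rightarrow> complex) \<Rightarrow> complex^3 \<Rightarrow> complex^3 \<Rightarrow> bool" where
  "bitangent_basis F p q \<longleftrightarrow> (\<exists>k. k \<noteq> 0 \<and>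
     ((\<forall>x y. F (x *s p + y *s q) = k * x^2 * y^2) \<or> (\<forall>x y. F (x *s p + y *s q) = k * y^4)))"

text \<open>Multiplicity 2 at \<open>p\<close> kills the coefficients of \<open>x^4\<close> and
  \<open>x^3 y\<close>, multiplicity 2 at \<open>p'\<close> those of \<open>y^4\<close> and
  \<open>x y^3\<close>, so only \<open>x^2 y^2\<close> survives. For a single contact point,
  multiplicity 4 leaves only \<open>y^4\<close>.\<close>

lemma bitangent_imp_basis:
  assumes quartic: "\<And>p q. \<exists>g. \<forall>x y. F (x *s p + y *s q) = binary_form 4 g x y"
    and bit: "bitangent F L"
  obtains p q where "vec.dim {p, q} = 2" "L = vec.span {p, q}" "bitangent_basis F p q"
proof -
  have L: "L \<in> proj_lines" using bit unfolding bitangent_def by (elim conjE)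
  obtain v where v: "v \<in> L" "F v \<noteq> 0" using bit unfolding bitangent_def by (elim conjE bexE)
  obtain P P' where P: "P \<in> proj_points" "P' \<in> proj_points" "P \<subseteq> L" "P' \<subseteq> L"
    and mult': "\<forall>Q\<in>proj_points. Q \<subseteq> L \<longrightarrow>
      intersection_mult F L Q = 2 * of_bool (Q = P) + 2 * of_bool (Q = P')"
    using bit unfolding bitangent_def by (elim conjE bexE)
  have mult: "intersection_mult F L Q = 2 * of_bool (Q = P) + 2 * of_bool (Q = P')"
    if "Q \<in> proj_points" "Q \<subseteq> L" for Q
    using mult' that by simp
  obtain p where p: "p \<noteq> 0" "P = vec.span {p}" using P proj_points_iff by blast
  obtain p' where p': "p' \<noteq> 0" "P' = vec.span {p'}" using P proj_points_iff by blast
  have pL: "p \<in> L" "p' \<in> L"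
    using P p p' vec.span_base[of p "{p}"] vec.span_base[of p' "{p'}"] by auto
  show thesis
  proof (cases "P = P'")
    case True
    obtain q where q: "vec.dim {p, q} = 2" "L = vec.span {p, q}"
      using proj_line_obtain_basis[OF L pL(1) p(1)] .
    obtain g where g: "\<And>x y. F (x *s p + y *s q) = binary_form 4 g x y" using quartic by blast
    have "intersection_mult F L (vec.span {p}) = 4" using mult[of P] P p True by simp
    with intersection_mult_least[OF q g v] have "g 4 \<noteq> 0" "\<And>i. i < 4 \<Longrightarrow> g i = 0"
      by simp_all
    then have "bitangent_basis F p q"
      unfolding bitangent_basis_def g binary_form_4 by (intro exI[of _ "g 4"]) auto
    then show thesis using that q by blast
  next
    case False
    then have q: "vec.dim {p, p'} = 2" using span_singleton_eq_iff[OF p(1) p'(1)] p p' by blast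
    then have L': "L = vec.span {p, p'}" using proj_line_eq_span[OF L pL] by blast
    obtain g where g: "\<And>x y. F (x *s p + y *s p') = binary_form 4 g x y" using quartic by blast
    have g': "F (x *s p' + y *s p) = binary_form 4 (\<lambda>i. g (4 - i)) x y" for x y
      using g[of y x] by (simp add: binary_form_4 add.commute mult_ac)
    have "intersection_mult F L (vec.span {p}) = 2" using mult[of P] P p False by simp
    with intersection_mult_least[OF q L' g v] have 1: "g 2 \<noteq> 0" "\<And>i. i < 2 \<Longrightarrow> g i = 0"
      by simp_all
    have "intersection_mult F L (vec.span {p'}) = 2" using mult[of P'] P p' False by simp
    moreover have "vec.dim {p', p} = 2" "L = vec.span {p', p}"
      using q L' by (simp_all add: insert_commute)
    ultimately have 2: "\<And>i. i < 2 \<Longrightarrow> g (4 - i) = 0"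
      using intersection_mult_least[OF _ _ g' v] by simp
    have "bitangent_basis F p p'"
      unfolding bitangent_basis_def g binary_form_4 using 1(1) 1(2)[of 0] 1(2)[of 1] 2[of 0] 2[of 1]
      by (intro exI[of _ "g 2"]) auto
    then show thesis using that q L' by blast
  qed
qed

text \<open>The multiplicity at a point is read off in a basis that starts with a representative of
  it. For a point other than \<open>vec.span {p}\<close> such a basis is \<open>(r, p)\<close>, and
  \<open>y \<noteq> 0\<close> enters the nonvanishing of the form at \<open>r\<close>.\<close>

lemma proj_point_on_span2_cases:
  assumes d: "vec.dim {p, q} = 2" and Q: "Q \<in> proj_points" "Q \<subseteq> vec.span {p, q}"
  obtains "Q = vec.span {p}"
  | r x y where "r = x *s p + y *s q" "y \<noteq> 0" "Q = vec.span {r}" "Q \<noteq> vec.span {p}"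
      "vec.dim {r, p} = 2" "vec.span {p, q} = vec.span {r, p}"
proof -
  define L where "L = vec.span {p, q}"
  have L: "L \<in> proj_lines" using d proj_lines_iff L_def by blast
  have p: "p \<noteq> 0" "p \<in> L"
    using dim_pair_nonzero[OF d] by (simp_all add: L_def vec.span_base)
  obtain r where r: "r \<noteq> 0" "Q = vec.span {r}" using Q proj_points_iff by blast
  then have rL: "r \<in> L" using Q vec.span_base[of r "{r}"] L_def by auto
  then obtain x y where xy: "r = x *s p + y *s q" using in_span2 L_def by blast
  show thesis
  proof (cases "Q = vec.span {p}")
    case True
    then show thesis using that(1) by simp
  next
    case False
    then have rp: "vec.dim {r, p} = 2" using span_singleton_eq_iff[OF r(1) p(1)] r by simp
    have "y \<noteq> 0"
    proof
      assume "y = 0"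
      then have "1 *s r + (- x) *s p = 0" using xy by simp
      then show False using rp unfolding dim_pair_eq_2_iff by (metis zero_neq_one)
    qed
    then show thesis
      using that(2)[OF xy _ r(2) False rp] proj_line_eq_span[OF L rL p(2) rp] L_def by simp
  qed
qed

lemma bitangentI_two_points:
  assumes d: "vec.dim {p, q} = 2" and k: "k \<noteq> 0"
    and F: "\<And>x y. F (x *s p + y *s q) = k * x^2 * y^2"
  shows "bitangent F (vec.span {p, q})"
proof -
  note ind = d[unfolded dim_pair_eq_2_iff, rule_format]
  let ?L = "vec.span {p, q}"
  have L: "?L \<in> proj_lines" using d proj_lines_iff by blast
  have nz: "p \<noteq> 0" "q \<noteq> 0" using dim_pair_nonzero[OF d] by auto
  have pts: "vec.span {p} \<in> proj_points" "vec.span {q} \<in> proj_points"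
    using nz proj_points_iff by blast+
  have pq: "p \<in> ?L" "q \<in> ?L" "p + q \<in> ?L"
    by (auto intro: vec.span_base vec.span_add)
  have sub: "vec.span {p} \<subseteq> ?L" "vec.span {q} \<subseteq> ?L"
    by (auto intro!: vec.span_mono)
  have d': "vec.dim {q, p} = 2" using d by (simp add: insert_commute)
  have ne: "vec.span {p} \<noteq> vec.span {q}" using d span_singleton_eq_iff[OF nz] by simp
  have 1: "intersection_mult F ?L (vec.span {p}) = 2"
    by (rule intersection_mult_eq[OF d, of _ 4 "\<lambda>i. if i = 2 then k else 0"])
      (simp_all add: F binary_form_4 k)
  have F': "F (x *s q + y *s p) = k * x^2 * y^2" for x y
    using F[of y x] by (simp add: add.commute mult_ac)
  have "intersection_mult F (vec.span {q, p}) (vec.span {q}) = 2"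
    by (rule intersection_mult_eq[OF d', of _ 4 "\<lambda>i. if i = 2 then k else 0"])
      (simp_all add: F' binary_form_4 k)
  then have 2: "intersection_mult F ?L (vec.span {q}) = 2" by (simp add: insert_commute)
  have "intersection_mult F ?L Q = 2 * of_bool (Q = vec.span {p}) + 2 * of_bool (Q = vec.span {q})"
    if Q: "Q \<in> proj_points" "Q \<subseteq> ?L" for Q
    using d Q
  proof (cases rule: proj_point_on_span2_cases)
    case 1
    then show ?thesis using \<open>intersection_mult F ?L (vec.span {p}) = 2\<close> ne by simp
  next
    case r: (2 r x y)
    then have r0: "r \<noteq> 0" using dim_pair_nonzero by blast
    show ?thesis
    proof (cases "x = 0")
      case True
      then have "r \<in> vec.span {q}" using r in_span1 by auto
      then have "vec.dim {r, q} \<noteq> 2" by (simp add: vec.dim_insert)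
      then have "Q = vec.span {q}" using span_singleton_eq_iff[OF r0 nz(2)] r by simp
      then show ?thesis using 2 ne by simp
    next
      case False
      have "Q \<noteq> vec.span {q}"
      proof
        assume "Q = vec.span {q}"
        then have "r \<in> vec.span {q}" using r vec.span_base[of r "{r}"] by auto
        then obtain z where "r = z *s q" using in_span1 by blast
        then have "x *s p + (y - z) *s q = 0" using r by (simp add: vec_eq_iff algebra_simps)
        then show False using ind False by blast
      qed
      \<comment> \<open>This is \<open>k * (s * x + t)^2 * (s * y)^2\<close> expanded; the
        coefficient of \<open>s^4\<close> is nonzero, so the multiplicity at \<open>r\<close> is
        0.\<close>
      moreover have "F (s *s r + t *s p) = binary_form 4 (\<lambda>i. if i = 0 then k * x^2 * y^2 else
          if i = 1 then 2 * k * x * y^2 else if i = 2 then k * y^2 else 0) s t" for s t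
      proof -
        have "s *s r + t *s p = (s * x + t) *s p + (s * y) *s q"
          unfolding r(1) by (simp add: vec_eq_iff algebra_simps)
        then have "F (s *s r + t *s p) = k * (s * x + t)^2 * (s * y)^2" by (simp only: F)
        then show ?thesis unfolding binary_form_4
          by (simp add: power2_eq_square power3_eq_cube power4_eq_xxxx algebra_simps)
      qed
      then have "intersection_mult F ?L Q = 0" unfolding r(3) r(6)
        by (rule intersection_mult_eq[OF r(5)]) (use False r(2) k in simp_all)
      ultimately show ?thesis using r(4) by simp
    qed
  qed
  moreover have "F (p + q) \<noteq> 0" using F[of 1 1] k by simp
  ultimately show ?thesis unfolding bitangent_def using L pts sub pq(3) by blast
qed

lemma bitangentI_one_point:
  assumes d: "vec.dim {p, q} = 2" and k: "k \<noteq> 0"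
    and F: "\<And>x y. F (x *s p + y *s q) = k * y^4"
  shows "bitangent F (vec.span {p, q})"
proof -
  note ind = d[unfolded dim_pair_eq_2_iff, rule_format]
  let ?L = "vec.span {p, q}"
  have L: "?L \<in> proj_lines" using d proj_lines_iff by blast
  have nz: "p \<noteq> 0" "q \<noteq> 0" using dim_pair_nonzero[OF d] by auto
  have pts: "vec.span {p} \<in> proj_points" "vec.span {q} \<in> proj_points"
    using nz proj_points_iff by blast+
  have pq: "p \<in> ?L" "q \<in> ?L" "p + q \<in> ?L"
    by (auto intro: vec.span_base vec.span_add)
  have sub: "vec.span {p} \<subseteq> ?L" "vec.span {q} \<subseteq> ?L"
    by (auto intro!: vec.span_mono)
  have 1: "intersection_mult F ?L (vec.span {p}) = 4"
    by (rule intersection_mult_eq[OF d, of _ 4 "\<lambda>i. if i = 4 then k else 0"])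
      (simp_all add: F binary_form_4 k)
  have "intersection_mult F ?L Q = 2 * of_bool (Q = vec.span {p}) + 2 * of_bool (Q = vec.span {p})"
    if Q: "Q \<in> proj_points" "Q \<subseteq> ?L" for Q
    using d Q
  proof (cases rule: proj_point_on_span2_cases)
    case 1
    then show ?thesis using \<open>intersection_mult F ?L (vec.span {p}) = 4\<close> by simp
  next
    case r: (2 r x y)
    have "F (s *s r + t *s p) = binary_form 4 (\<lambda>i. if i = 0 then k * y^4 else 0) s t" for s t
    proof -
      have "s *s r + t *s p = (s * x + t) *s p + (s * y) *s q"
        unfolding r(1) by (simp add: vec_eq_iff algebra_simps)
      then have "F (s *s r + t *s p) = k * (s * y)^4" by (simp only: F)
      then show ?thesis by (simp add: binary_form_4 power_mult_distrib)
    qed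
    then have "intersection_mult F ?L Q = 0" unfolding r(3) r(6)
      by (rule intersection_mult_eq[OF r(5)]) (use r(2) k in simp_all)
    then show ?thesis using r(4) by simp
  qed
  moreover have "F q \<noteq> 0" using F[of 0 1] k by simp
  ultimately show ?thesis unfolding bitangent_def using L pts(1) sub(1) pq(2) by blast
qed

section \<open>Bitangency as a square condition in an arbitrary basis\<close>

lemma quadratic_form_factor:
  fixes a b c :: complex
  obtains \<alpha> \<beta> \<gamma> \<delta> where "\<And>s t. a * s^2 + b * s * t + c * t^2 = (\<alpha> * s + \<beta> * t) * (\<gamma> * s + \<delta> * t)"
proof (cases "a = 0")
  case True
  then have "a * s^2 + b * s * t + c * t^2 = (0 * s + 1 * t) * (b * s + c * t)" for s t
    by (simp add: power2_eq_square algebra_simps)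
  then show thesis using that by blast
next
  case False
  define d where "d = csqrt (b^2 - 4 * a * c)"
  have "(b - d) * (b + d) = 4 * a * c"
    using power2_csqrt[of "b^2 - 4 * a * c"] by (simp add: d_def power2_eq_square algebra_simps)
  then have d: "(b - d) / 2 * ((b + d) / (2 * a)) = c" using False by (simp add: field_simps)
  have "a * s^2 + b * s * t + c * t^2 = (a * s + (b - d) / 2 * t) * (1 * s + (b + d) / (2 * a) * t)" for s t
    unfolding d[symmetric] using False by (simp add: field_simps power2_eq_square)
  then show thesis using that by blast
qed

text \<open>Squares of quadratic forms are stable under linear substitution. Forwards,
  \<open>k x^2 y^2\<close> and \<open>k y^4\<close> are squares because \<open>k\<close> has a
  square root; backwards, the quadratic form splits into two linear factors, whose zeros are the
  contact points.\<close>

lemma bitangent_span_iff: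
  assumes quartic: "\<And>p q. \<exists>g. \<forall>x y. F (x *s p + y *s q) = binary_form 4 g x y"
    and d: "vec.dim {p, q} = 2"
  shows "bitangent F (vec.span {p, q}) \<longleftrightarrow>
    (\<exists>a b c. (a \<noteq> 0 \<or> b \<noteq> 0 \<or> c \<noteq> 0) \<and>
      (\<forall>s t. F (s *s p + t *s q) = (a * s^2 + b * s * t + c * t^2)^2))"
proof
  assume bit: "bitangent F (vec.span {p, q})"
  obtain p' q' where d': "vec.dim {p', q'} = 2" and L: "vec.span {p, q} = vec.span {p', q'}"
    and b: "bitangent_basis F p' q'"
    using bitangent_imp_basis[OF quartic bit] by blast
  have "p \<in> vec.span {p', q'}" "q \<in> vec.span {p', q'}"
    unfolding L[symmetric] by (simp_all add: vec.span_base)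
  then obtain x1 y1 x2 y2 where p: "p = x1 *s p' + y1 *s q'" and q: "q = x2 *s p' + y2 *s q'"
    using in_span2 by metis
  have pq: "s *s p + t *s q = (s * x1 + t * x2) *s p' + (s * y1 + t * y2) *s q'" for s t
    unfolding p q by (simp add: vec_eq_iff algebra_simps)
  have ex: "\<exists>a b c. \<forall>s t. F (s *s p + t *s q) = (a * s^2 + b * s * t + c * t^2)^2"
  proof -
    from b obtain k where k:
      "(\<forall>x y. F (x *s p' + y *s q') = k * x^2 * y^2) \<or> (\<forall>x y. F (x *s p' + y *s q') = k * y^4)"
      unfolding bitangent_basis_def by blast
    define \<kappa> where "\<kappa> = csqrt k"
    have "k = \<kappa>^2" by (simp add: \<kappa>_def)
    with k consider "\<And>x y. F (x *s p' + y *s q') = \<kappa>^2 * x^2 * y^2"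
      | "\<And>x y. F (x *s p' + y *s q') = \<kappa>^2 * y^4"
      by blast
    then show ?thesis
    proof cases
      case F: 1
      have "F (s *s p + t *s q) = ((\<kappa> * (x1 * y1)) * s^2 +
          (\<kappa> * (x1 * y2 + x2 * y1)) * s * t + (\<kappa> * (x2 * y2)) * t^2)^2" for s t
      proof -
        have "F (s *s p + t *s q) = \<kappa>^2 * (s * x1 + t * x2)^2 * (s * y1 + t * y2)^2"
          unfolding pq F by simp
        also have "\<dots> = ((\<kappa> * (x1 * y1)) * s^2 +
            (\<kappa> * (x1 * y2 + x2 * y1)) * s * t + (\<kappa> * (x2 * y2)) * t^2)^2"
          by algebra
        finally show ?thesis .
      qed
      then show ?thesis by blast
    next
      case F: 2
      have "F (s *s p + t *s q) = ((\<kappa> * y1^2) * s^2 +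
          (\<kappa> * (2 * y1 * y2)) * s * t + (\<kappa> * y2^2) * t^2)^2" for s t
      proof -
        have "F (s *s p + t *s q) = \<kappa>^2 * (s * y1 + t * y2)^4"
          unfolding pq F by simp
        also have "\<dots> = ((\<kappa> * y1^2) * s^2 +
            (\<kappa> * (2 * y1 * y2)) * s * t + (\<kappa> * y2^2) * t^2)^2"
          by algebra
        finally show ?thesis .
      qed
      then show ?thesis by blast
    qed
  qed
  obtain v where "v \<in> vec.span {p, q}" "F v \<noteq> 0"
    using bit unfolding bitangent_def by (elim conjE bexE)
  then obtain x y where "F (x *s p + y *s q) \<noteq> 0" using in_span2 by metis
  then show "\<exists>a b c. (a \<noteq> 0 \<or> b \<noteq> 0 \<or> c \<noteq> 0) \<and>
      (\<forall>s t. F (s *s p + t *s q) = (a * s^2 + b * s * t + c * t^2)^2)"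
  proof -
    obtain a b c where sq: "\<And>s t. F (s *s p + t *s q) = (a * s^2 + b * s * t + c * t^2)^2"
      using ex by blast
    then have "a \<noteq> 0 \<or> b \<noteq> 0 \<or> c \<noteq> 0" using \<open>F (x *s p + y *s q) \<noteq> 0\<close> by auto
    then show ?thesis using sq by blast
  qed
next
  assume "\<exists>a b c. (a \<noteq> 0 \<or> b \<noteq> 0 \<or> c \<noteq> 0) \<and>
      (\<forall>s t. F (s *s p + t *s q) = (a * s^2 + b * s * t + c * t^2)^2)"
  then obtain a b c where nz: "a \<noteq> 0 \<or> b \<noteq> 0 \<or> c \<noteq> 0"
    and F0: "\<And>s t. F (s *s p + t *s q) = (a * s^2 + b * s * t + c * t^2)^2" by blast
  obtain \<alpha> \<beta> \<gamma> \<delta> where fac: "\<And>s t. a * s^2 + b * s * t + c * t^2 = (\<alpha> * s + \<beta> * t) * (\<gamma> * s + \<delta> * t)"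
    using quadratic_form_factor[of a b c] by blast
  have F: "F (s *s p + t *s q) = ((\<alpha> * s + \<beta> * t) * (\<gamma> * s + \<delta> * t))^2" for s t
    using F0 fac by simp
  have coeffs: "a = \<alpha> * \<gamma>" "c = \<beta> * \<delta>" "a + b + c = (\<alpha> + \<beta>) * (\<gamma> + \<delta>)"
    using fac[of 1 0] fac[of 0 1] fac[of 1 1] by simp_all
  have nz1: "\<alpha> \<noteq> 0 \<or> \<beta> \<noteq> 0" using nz coeffs by auto
  have nz2: "\<gamma> \<noteq> 0 \<or> \<delta> \<noteq> 0" using nz coeffs by auto
  have L: "vec.span {p, q} \<in> proj_lines" using d proj_lines_iff by blast
  have new_basis: "vec.dim {x1 *s p + y1 *s q, x2 *s p + y2 *s q} = 2 \<and>
     vec.span {p, q} = vec.span {x1 *s p + y1 *s q, x2 *s p + y2 *s q}"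
    if "x1 * y2 - x2 * y1 \<noteq> 0" for x1 y1 x2 y2
  proof -
    have "vec.dim {x1 *s p + y1 *s q, x2 *s p + y2 *s q} = 2"
      unfolding dim_pair_eq_2_iff
    proof (intro allI impI)
      fix x y assume "x *s (x1 *s p + y1 *s q) + y *s (x2 *s p + y2 *s q) = 0"
      then have "(x * x1 + y * x2) *s p + (x * y1 + y * y2) *s q = 0"
        by (simp add: vec_eq_iff algebra_simps)
      then have "x * x1 + y * x2 = 0" "x * y1 + y * y2 = 0"
        using d[unfolded dim_pair_eq_2_iff] by blast+
      then have "x * (x1 * y2 - x2 * y1) = 0" "y * (x1 * y2 - x2 * y1) = 0" by algebra+
      then show "x = 0 \<and> y = 0" using that by simp
    qed
    moreover have "x *s p + y *s q \<in> vec.span {p, q}" for x y using in_span2 by blast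
    ultimately show ?thesis using proj_line_eq_span[OF L] by simp
  qed
  have F': "F (x *s (x1 *s p + y1 *s q) + y *s (x2 *s p + y2 *s q)) =
      ((\<alpha> * (x * x1 + y * x2) + \<beta> * (x * y1 + y * y2)) *
       (\<gamma> * (x * x1 + y * x2) + \<delta> * (x * y1 + y * y2)))^2" for x y x1 y1 x2 y2
  proof -
    have "x *s (x1 *s p + y1 *s q) + y *s (x2 *s p + y2 *s q) =
        (x * x1 + y * x2) *s p + (x * y1 + y * y2) *s q"
      by (simp add: vec_eq_iff algebra_simps)
    then show ?thesis by (simp only: F)
  qed
  show "bitangent F (vec.span {p, q})"
  proof (cases "\<alpha> * \<delta> - \<beta> * \<gamma> = 0")
    case False
    define \<Delta> where "\<Delta> = \<alpha> * \<delta> - \<beta> * \<gamma>"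
    \<comment> \<open>Each new basis vector is a zero of one factor and gives the other the value
      \<open>\<Delta>\<close>: \<open>(\<delta>, - \<gamma>)\<close> kills the second factor,
      \<open>(- \<beta>, \<alpha>)\<close> the first.\<close>
    have "\<delta> * \<alpha> - (- \<beta>) * (- \<gamma>) \<noteq> 0" using False by (simp add: mult_ac)
    note nb = new_basis[OF this]
    show ?thesis unfolding conjunct2[OF nb]
    proof (rule bitangentI_two_points[OF conjunct1[OF nb]])
      show "\<Delta>^4 \<noteq> 0" using False by (simp add: \<Delta>_def)
      fix x y
      show "F (x *s (\<delta> *s p + (- \<gamma>) *s q) + y *s ((- \<beta>) *s p + \<alpha> *s q)) = \<Delta>^4 * x^2 * y^2"
        unfolding F' \<Delta>_def by algebra
    qed
  next
    case True
    \<comment> \<open>The factors are proportional with common zero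
      \<open>(- \<beta>, \<alpha>)\<close>, the contact point; the second basis vector has to avoid
      that zero.\<close>
    obtain x2 y2 where xy: "\<alpha> * x2 + \<beta> * y2 \<noteq> 0" "\<gamma> * x2 + \<delta> * y2 \<noteq> 0"
    proof (cases "\<alpha> = 0")
      case A: False
      have "\<gamma> \<noteq> 0"
      proof
        assume "\<gamma> = 0"
        then show False using True A nz2 by simp
      qed
      then show thesis using that[of 1 0] A by simp
    next
      case A: True
      then have "\<gamma> = 0" "\<beta> \<noteq> 0" "\<delta> \<noteq> 0" using True nz1 nz2 by auto
      then show thesis using that[of 0 1] by simp
    qed
    have "(- \<beta>) * y2 - x2 * \<alpha> = - (\<alpha> * x2 + \<beta> * y2)" by simp
    then have "(- \<beta>) * y2 - x2 * \<alpha> \<noteq> 0" using xy(1) neg_equal_0_iff_equal by metis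
    note nb = new_basis[OF this]
    show ?thesis unfolding conjunct2[OF nb]
    proof (rule bitangentI_one_point[OF conjunct1[OF nb]])
      show "((\<alpha> * x2 + \<beta> * y2) * (\<gamma> * x2 + \<delta> * y2))^2 \<noteq> 0" using xy by simp
      fix x y
      have "\<gamma> * (x * - \<beta> + y * x2) + \<delta> * (x * \<alpha> + y * y2) = y * (\<gamma> * x2 + \<delta> * y2)"
        using True by algebra
      moreover have "\<alpha> * (x * - \<beta> + y * x2) + \<beta> * (x * \<alpha> + y * y2) = y * (\<alpha> * x2 + \<beta> * y2)"
        by algebra
      ultimately show "F (x *s ((- \<beta>) *s p + \<alpha> *s q) + y *s (x2 *s p + y2 *s q)) =
          ((\<alpha> * x2 + \<beta> * y2) * (\<gamma> * x2 + \<delta> * y2))^2 * y^4"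
        unfolding F' by (simp add: power_mult_distrib flip: power_add)
    qed
  qed
qed

section \<open>Lines in dual coordinates\<close>

definition proj_line_of :: "complex^3 \<Rightarrow> (complex^3) set" where
  "proj_line_of w = {v. w$1 * v$1 + w$2 * v$2 + w$3 * v$3 = 0}"

lemma vec3_eq_iff: "v = w \<longleftrightarrow> v$1 = w$1 \<and> v$2 = w$2 \<and> v$3 = (w :: complex^3)$3"
  by (simp add: vec_eq_iff forall_3)

lemma proj_line_of_scale: "k \<noteq> 0 \<Longrightarrow> proj_line_of (k *s w) = proj_line_of w"
  by (simp add: proj_line_of_def mult.assoc flip: distrib_left)

text \<open>Three parametrizations, chosen by the last nonzero coefficient; they are the lines
  \<open>z = u x + v y\<close>, \<open>y = u x\<close> and \<open>x = 0\<close>.\<close>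

lemma proj_line_of_eq_span:
  "w$3 \<noteq> 0 \<Longrightarrow> proj_line_of w =
     vec.span {vector [1, 0, - w$1 / w$3], vector [0, 1, - w$2 / w$3]}"
  "w$3 = 0 \<Longrightarrow> w$2 \<noteq> 0 \<Longrightarrow> proj_line_of w = vec.span {vector [1, - w$1 / w$2, 0], vector [0, 0, 1]}"
  "w$3 = 0 \<Longrightarrow> w$2 = 0 \<Longrightarrow> w$1 \<noteq> 0 \<Longrightarrow> proj_line_of w = vec.span {vector [0, 1, 0], vector [0, 0, 1]}"
  by (auto simp: proj_line_of_def in_span2 vec3_eq_iff field_simps add_eq_0_iff)

lemma dim_chart:
  "vec.dim {vector [1, 0, u], vector [0, 1, v] :: complex^3} = 2"
  "vec.dim {vector [1, u, 0], vector [0, 0, 1] :: complex^3} = 2"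
  "vec.dim {vector [0, 1, 0], vector [0, 0, 1] :: complex^3} = 2"
  by (auto simp: dim_pair_eq_2_iff vec3_eq_iff)

lemma proj_line_of_in_proj_lines: "w \<noteq> 0 \<Longrightarrow> proj_line_of w \<in> proj_lines"
proof -
  assume "w \<noteq> 0"
  then consider "w$3 \<noteq> 0" | "w$3 = 0" "w$2 \<noteq> 0" | "w$3 = 0" "w$2 = 0" "w$1 \<noteq> 0"
    by (auto simp: vec3_eq_iff)
  then show ?thesis
    unfolding proj_lines_iff using proj_line_of_eq_span[of w] dim_chart by cases blast+
qed

text \<open>Used on both sides of duality: it gives the coefficients of the line through two points
  and the point common to two lines.\<close>

definition cross :: "complex^3 \<Rightarrow> complex^3 \<Rightarrow> complex^3" where
  "cross p q = vector [p$2 * q$3 - p$3 * q$2, p$3 * q$1 - p$1 * q$3, p$1 * q$2 - p$2 * q$1]"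

lemma cross_eq_0_iff: "cross p q = 0 \<longleftrightarrow> vec.dim {p, q} \<noteq> 2"
proof
  assume *: "cross p q = 0"
  show "vec.dim {p, q} \<noteq> 2"
  proof
    assume d: "vec.dim {p, q} = 2"
    note ind = d[unfolded dim_pair_eq_2_iff, rule_format]
    \<comment> \<open>The 2 x 2 minors vanish, so this relation holds for every index, and
      independence forces all coordinates of \<open>q\<close> to be 0.\<close>
    have "q$i *s p + (- p$i) *s q = 0" for i
      using * exhaust_3[of i] by (auto simp: cross_def vec3_eq_iff algebra_simps)
    then have "q$i = 0" for i using ind by blast
    then have "q = 0" by (simp add: vec_eq_iff)
    then show False using dim_pair_nonzero[OF d] by simp
  qed
next
  assume "vec.dim {p, q} \<noteq> 2"
  then obtain x y where xy: "x *s p + y *s q = 0" "x \<noteq> 0 \<or> y \<noteq> 0" unfolding dim_pair_eq_2_iff by blast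
  then have e: "x * p$i + y * q$i = 0" for i by (simp add: vec_eq_iff)
  have "x * (p$i * q$j - p$j * q$i) = 0" "y * (p$i * q$j - p$j * q$i) = 0" for i j
    using e[of i] e[of j] by algebra+
  then have "p$i * q$j - p$j * q$i = 0" for i j using xy(2) by (metis mult_eq_0_iff)
  then show "cross p q = 0" by (simp add: cross_def vec3_eq_iff)
qed

lemma proj_lines_obtain:
  assumes "L \<in> proj_lines"
  obtains w where "w \<noteq> 0" "L = proj_line_of w"
proof -
  obtain p q where d: "vec.dim {p, q} = 2" and L: "L = vec.span {p, q}"
    using assms proj_lines_iff by blast
  have nz: "cross p q \<noteq> 0" using d cross_eq_0_iff by blast
  have "p \<in> proj_line_of (cross p q)" "q \<in> proj_line_of (cross p q)"
    by (simp_all add: proj_line_of_def cross_def algebra_simps)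
  then have "L = proj_line_of (cross p q)"
    using proj_line_eq_span[OF proj_line_of_in_proj_lines[OF nz] _ _ d] L by simp
  then show thesis using that nz by blast
qed

section \<open>Restrictions of the Klein quartic\<close>

text \<open>Five values determine a binary quartic: \<open>A\<close> and \<open>E\<close> come from
  \<open>(1, 0)\<close> and \<open>(0, 1)\<close>, the other coefficients from
  \<open>(1, 1)\<close>, \<open>(1, -1)\<close> and \<open>(1, 2)\<close>.\<close>

lemma quartic_eq_square_iff:
  fixes A B C D E a b c :: complex
  shows "(\<forall>s t. A * s^4 + B * s^3 * t + C * s^2 * t^2 + D * s * t^3 + E * t^4 =
      (a * s^2 + b * s * t + c * t^2)^2) \<longleftrightarrow>
    A = a^2 \<and> B = 2 * a * b \<and> C = b^2 + 2 * a * c \<and> D = 2 * b * c \<and> E = c^2"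
    (is "?l \<longleftrightarrow> ?r")
proof
  assume ?l
  note * = this[rule_format]
  have A: "A = a^2" and E: "E = c^2" using *[of 1 0] *[of 0 1] by simp_all
  have 1: "B + C + D = (a + b + c)^2 - a^2 - c^2" using *[of 1 1] A E by (simp add: algebra_simps)
  have 2: "- B + C - D = (a - b + c)^2 - a^2 - c^2" using *[of 1 "-1"] A E by (simp add: algebra_simps)
  have 3: "2 * B + 4 * C + 8 * D = (a + 2 * b + 4 * c)^2 - a^2 - 16 * c^2"
    using *[of 1 2] A E by (simp add: algebra_simps)
  have C: "C = b^2 + 2 * a * c" using 1 2 by algebra
  have "6 * D = 6 * (2 * b * c)" using 1 3 C by algebra
  then have D: "D = 2 * b * c" by simp
  have "B = 2 * a * b" using 1 C D by algebra
  then show ?r using A C D E by blast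
next
  assume ?r
  then show ?l by (simp add: power2_eq_square power3_eq_cube power4_eq_xxxx algebra_simps)
qed

text \<open>Writing \<open>(a s\<^sup>2 + b s t + c t\<^sup>2)\<^sup>2\<close> as \<open>A s\<^sup>4 + B s\<^sup>3 t + C s\<^sup>2 t\<^sup>2 + D s t\<^sup>3 + E t\<^sup>4\<close>, elimination of
  \<open>a, b, c\<close> gives \<open>A D\<^sup>2 = B\<^sup>2 E\<close>, which for the quartic below factors as
  \<open>u\<^sup>2 v\<^sup>2 (l\<^sup>2 - 4) (u\<^sup>2 - v\<^sup>2) (u\<^sup>2 + v\<^sup>2 + l) = 0\<close>, and \<open>B\<^sup>3 - 4 A B C + 8 A\<^sup>2 D = 0\<close>.\<close>

lemma klein_restriction_square_iff:
  fixes l u v :: complex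
  assumes l: "l \<noteq> 2" "l \<noteq> -2" "l \<noteq> -1" "l \<noteq> 1"
  defines "A \<equiv> 1 + l * u^2 + u^4" and "B \<equiv> 2 * u * v * (2 * u^2 + l)"
    and "C \<equiv> 6 * u^2 * v^2 + l * (1 + u^2 + v^2)"
    and "D \<equiv> 2 * u * v * (2 * v^2 + l)" and "E \<equiv> 1 + l * v^2 + v^4"
  shows "(\<exists>a b c. (a \<noteq> 0 \<or> b \<noteq> 0 \<or> c \<noteq> 0) \<and>
      A = a^2 \<and> B = 2 * a * b \<and> C = b^2 + 2 * a * c \<and> D = 2 * b * c \<and> E = c^2) \<longleftrightarrow>
    u = 0 \<and> (l + 2) * (v^4 + 1) + 2 * l * v^2 = 0 \<or>
    v = 0 \<and> (l + 2) * (u^4 + 1) + 2 * l * u^2 = 0 \<or>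
    u^2 = 1 \<and> v^2 = 1 \<or>
    u^2 = v^2 \<and> (l + 1) * u^2 = -1 \<or>
    u^2 = 1 \<and> v^2 = - l - 1 \<or>
    v^2 = 1 \<and> u^2 = - l - 1" (is "?l \<longleftrightarrow> ?r")
proof
  assume ?l
  then obtain a b c where A: "A = a^2" and B: "B = 2 * a * b" and C: "C = b^2 + 2 * a * c"
    and D: "D = 2 * b * c" and E: "E = c^2" by blast
  have l2: "l - 2 \<noteq> 0" "l + 2 \<noteq> 0" "l + 1 \<noteq> 0" "l - 1 \<noteq> 0" using l by (simp_all flip: eq_neg_iff_add_eq_0)
  consider "u = 0" | "v = 0" | "u \<noteq> 0" "v \<noteq> 0" by blast
  then show ?r
  proof cases
    case 1
    then have "b = 0" using A B by (auto simp: A_def B_def)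
    \<comment> \<open>With \<open>b = 0\<close> the square is \<open>(a s^2 + c t^2)^2\<close>,
      which gives this relation; a factor \<open>l - 2\<close> then splits off.\<close>
    then have "C^2 = 4 * A * E" using A C E by algebra
    then have "(l - 2) * ((l + 2) * (v^4 + 1) + 2 * l * v^2) = 0"
      using 1 unfolding A_def C_def E_def by algebra
    then show ?r using 1 l2 by simp
  next
    case 2
    then have "b = 0" using E D by (auto simp: E_def D_def)
    then have "C^2 = 4 * A * E" using A C E by algebra
    then have "(l - 2) * ((l + 2) * (u^4 + 1) + 2 * l * u^2) = 0"
      using 2 unfolding A_def C_def E_def by algebra
    then show ?r using 2 l2 by simp
  next
    case 3
    have "A * D^2 = B^2 * E" using A B D E by algebra
    then have "4 * (u * v)^2 * ((l - 2) * (l + 2) * ((u^2 - v^2) * (u^2 + v^2 + l))) = 0"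
      unfolding A_def B_def D_def E_def by algebra
    then have UV: "(u^2 - v^2) * (u^2 + v^2 + l) = 0" using 3 l2 by simp
    have "B^3 - 4 * A * B * C + 8 * A^2 * D = 0" using A B C D by algebra
    then have "8 * (u * v) * (u^2 * v^2 * (2 * u^2 + l)^3 - (2 * u^2 + l) * A * C + 2 * A^2 * (2 * v^2 + l)) = 0"
      unfolding B_def D_def by algebra
    then have R: "u^2 * v^2 * (2 * u^2 + l)^3 - (2 * u^2 + l) * A * C + 2 * A^2 * (2 * v^2 + l) = 0"
      using 3 by simp
    \<comment> \<open>This factor is cancelled in both cases below. If it were 0, then
      \<open>A \<noteq> 0\<close> and \<open>B = 0\<close> would force \<open>b = 0\<close> and
      \<open>C = 2 A\<close> or \<open>C = - 2 A\<close>, against the excluded values of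
      \<open>l\<close>.\<close>
    have nz: "2 * u^2 + l \<noteq> 0"
    proof
      assume *: "2 * u^2 + l = 0"
      have "4 * A = - (l + 2) * (l - 2)" using * unfolding A_def by algebra
      then have "4 * A \<noteq> 0" using l2 by (metis mult_eq_0_iff neg_equal_0_iff_equal)
      then have "a \<noteq> 0" using A by auto
      moreover have "B = 0" using * B_def by simp
      ultimately have "b = 0" using B by simp
      then have CC: "C^2 = 4 * A * E" using A C E by algebra
      have v: "u^2 = v^2" using UV * by algebra
      have "E = A" unfolding A_def E_def using v by algebra
      then have "(C - 2 * A) * (C + 2 * A) = 0" using CC by (simp add: power2_eq_square algebra_simps)
      moreover have "C - 2 * A = (l + 2) * (l - 1)"
        using * v unfolding A_def C_def by algebra
      moreover have "C + 2 * A = l + 2" using * v unfolding A_def C_def by algebra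
      ultimately show False using l2 by simp
    qed
    from UV consider "u^2 = v^2" | "u^2 + v^2 + l = 0" by auto
    then show ?r
    proof cases
      case v: 1
      have "(2 * u^2 + l) * ((l - 2) * ((u^2 - 1) * ((l + 1) * u^2 + 1))) = 0"
        using R v unfolding A_def C_def by algebra
      then have "u^2 = 1 \<or> (l + 1) * u^2 = -1" using l2 nz by (simp add: add_eq_0_iff2)
      then show ?r using v by auto
    next
      case v: 2
      have "(2 * u^2 + l) * ((l - 2) * ((u^2 - 1) * (u^2 + l + 1))) = 0"
        using R v unfolding A_def C_def by algebra
      then have "u^2 - 1 = 0 \<or> u^2 + l + 1 = 0" using l2 nz by simp
      then have "u^2 = 1 \<or> u^2 = - l - 1" by algebra
      moreover have "v^2 = - l - u^2" using v by algebra
      ultimately show ?r by auto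
    qed
  qed
next
  have l2: "l + 2 \<noteq> 0" "l + 1 \<noteq> 0" using l by (simp_all flip: eq_neg_iff_add_eq_0)
  \<comment> \<open>In the last four cases \<open>A\<close> and \<open>E\<close> are
    \<open>l + 2\<close> times a square, so \<open>a\<close> and \<open>c\<close> are multiples of
    \<open>k\<close>. Then \<open>B\<close> yields \<open>b\<close>, and \<open>C\<close> fixes the
    sign of \<open>c\<close> relative to \<open>a\<close>.\<close>
  define k where "k = csqrt (l + 2)"
  have k: "k^2 = l + 2" "k \<noteq> 0" using l2 by (auto simp: k_def)
  assume ?r
  then show ?l
  proof (elim disjE conjE)
    assume "u = 0" and v: "(l + 2) * (v^4 + 1) + 2 * l * v^2 = 0"
    show ?l
    proof (intro exI conjI)
      \<comment> \<open>Here \<open>A = 1\<close> and \<open>B = 0\<close> suggest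
        \<open>a = 1\<close> and \<open>b = 0\<close>, whence \<open>c = C / 2\<close>.\<close>
      show "A = 1^2" "B = 2 * 1 * 0" "C = 0^2 + 2 * 1 * (l * (1 + v^2) / 2)" "D = 2 * 0 * (l * (1 + v^2) / 2)"
        using \<open>u = 0\<close> by (simp_all add: A_def B_def C_def D_def)
      have "E * 4 = (l * (1 + v^2))^2" unfolding E_def using v by algebra
      then show "E = (l * (1 + v^2) / 2)^2" by (simp add: power_divide)
    qed simp
  next
    assume "v = 0" and u: "(l + 2) * (u^4 + 1) + 2 * l * u^2 = 0"
    show ?l
    proof (intro exI conjI)
      have "A * 4 = (l * (1 + u^2))^2" unfolding A_def using u by algebra
      then show "A = (l * (1 + u^2) / 2)^2" by (simp add: power_divide)
      show "B = 2 * (l * (1 + u^2) / 2) * 0" "C = 0^2 + 2 * (l * (1 + u^2) / 2) * 1"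
        "D = 2 * 0 * 1" "E = 1^2"
        using \<open>v = 0\<close> by (simp_all add: E_def B_def C_def D_def)
    qed simp
  next
    assume uv: "u^2 = 1" "v^2 = 1"
    show ?l
    proof (intro exI conjI)
      show "A = k^2" "E = k^2" using uv k unfolding A_def E_def by algebra+
      show "B = 2 * k * (k * u * v)" "C = (k * u * v)^2 + 2 * k * k" "D = 2 * (k * u * v) * k"
        using uv k unfolding B_def C_def D_def by algebra+
    qed (use k in simp)
  next
    assume uv: "u^2 = 1" "v^2 = - l - 1"
    show ?l
    proof (intro exI conjI)
      show "A = k^2" "E = (- k)^2" using uv k unfolding A_def E_def by algebra+
      show "B = 2 * k * (k * u * v)" "C = (k * u * v)^2 + 2 * k * (- k)" "D = 2 * (k * u * v) * (- k)"
        using uv k unfolding B_def C_def D_def by algebra+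
    qed (use k in simp)
  next
    assume uv: "v^2 = 1" "u^2 = - l - 1"
    show ?l
    proof (intro exI conjI)
      show "A = (- k)^2" "E = k^2" using uv k unfolding A_def E_def by algebra+
      show "B = 2 * (- k) * (k * u * v)" "C = (k * u * v)^2 + 2 * (- k) * k" "D = 2 * (k * u * v) * k"
        using uv k unfolding B_def C_def D_def by algebra+
    qed (use k in simp)
  next
    assume uv: "u^2 = v^2" "(l + 1) * u^2 = -1"
    have "u \<noteq> 0" using uv by auto
    show ?l
    proof (intro exI conjI)
      show "A = (k * u^2)^2" "E = (k * u^2)^2" using uv k unfolding A_def E_def by algebra+
      show "B = 2 * (k * u^2) * (k * u * v * (1 - l))"
        "C = (k * u * v * (1 - l))^2 + 2 * (k * u^2) * (k * u^2)"
        "D = 2 * (k * u * v * (1 - l)) * (k * u^2)"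
        using uv k unfolding B_def C_def D_def by algebra+
    qed (use k \<open>u \<noteq> 0\<close> in simp)
  qed
qed

text \<open>The form is a linear combination of products of two squares of coordinates, a fourth
  power being \<open>z^2 * z^2\<close>. Explicit coefficients are given only for such a product of
  restricted coordinates; sums and multiples follow by closure.\<close>

lemma klein_form_binary_quartic:
  "\<exists>g. \<forall>x y. klein_form l (x *s p + y *s q) = binary_form 4 g x y"
proof -
  let ?quartic = "\<lambda>f. \<exists>g. \<forall>x y. f x y = binary_form 4 g x y"
  have prod: "?quartic (\<lambda>x y. (x * a + y * a')^2 * (x * b + y * b')^2)" for a a' b b'
  proof (intro exI allI)
    fix x y
    show "(x * a + y * a')^2 * (x * b + y * b')^2 = binary_form 4 (\<lambda>i. [a^2 * b^2, 2 * a * a' * b^2 + 2 * a^2 * b * b',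
        a^2 * b'^2 + 4 * a * a' * b * b' + a'^2 * b^2, 2 * a * a' * b'^2 + 2 * a'^2 * b * b', a'^2 * b'^2] ! i) x y"
      unfolding binary_form_4 by (simp add: nth_Cons_numeral, algebra)
  qed
  have add: "?quartic (\<lambda>x y. f x y + f' x y)" if "?quartic f" "?quartic f'" for f f'
  proof -
    from that obtain g g' where "\<And>x y. f x y = binary_form 4 g x y" "\<And>x y. f' x y = binary_form 4 g' x y"
      by blast
    then have "f x y + f' x y = binary_form 4 (\<lambda>i. g i + g' i) x y" for x y
      by (simp add: binary_form_def sum.distrib algebra_simps)
    then show ?thesis by blast
  qed
  have scale: "?quartic (\<lambda>x y. k * f x y)" if "?quartic f" for f and k :: complex
  proof -
    from that obtain g where "\<And>x y. f x y = binary_form 4 g x y" by blast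
    then have "k * f x y = binary_form 4 (\<lambda>i. k * g i) x y" for x y
      by (simp add: binary_form_def sum_distrib_left mult.assoc)
    then show ?thesis by blast
  qed
  have fourth: "z ^ 4 = z^2 * z^2" for z :: complex by (simp flip: power_add)
  show ?thesis
    unfolding klein_form_def vector_add_component vector_smult_component fourth
    by (intro add scale prod)
qed

lemma klein_form_chart:
  fixes l u v s t :: complex
  shows "klein_form l (vector [s, t, u * s + v * t]) =
    (1 + l * u^2 + u^4) * s^4 + (2 * u * v * (2 * u^2 + l)) * s^3 * t +
    (6 * u^2 * v^2 + l * (1 + u^2 + v^2)) * s^2 * t^2 +
    (2 * u * v * (2 * v^2 + l)) * s * t^3 + (1 + l * v^2 + v^4) * t^4"
  unfolding klein_form_def vector_3 by algebra

text \<open>The hypothesis \<open>restr\<close> compares values only and does not ask for the line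
  \<open>z = u x + v y\<close> itself: since the form is symmetric in the coordinates, the lines
  \<open>y = u x\<close> and \<open>x = 0\<close> satisfy it after a permutation.\<close>

lemma klein_bitangent_chart_iff:
  fixes l u v :: complex
  assumes l: "l \<noteq> 2" "l \<noteq> -2" "l \<noteq> -1" "l \<noteq> 1"
    and d: "vec.dim {p, q} = 2"
    and restr: "\<And>s t. klein_form l (s *s p + t *s q) = klein_form l (vector [s, t, u * s + v * t])"
  shows "bitangent (klein_form l) (vec.span {p, q}) \<longleftrightarrow>
    u = 0 \<and> (l + 2) * (v^4 + 1) + 2 * l * v^2 = 0 \<or>
    v = 0 \<and> (l + 2) * (u^4 + 1) + 2 * l * u^2 = 0 \<or>
    u^2 = 1 \<and> v^2 = 1 \<or>
    u^2 = v^2 \<and> (l + 1) * u^2 = -1 \<or>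
    u^2 = 1 \<and> v^2 = - l - 1 \<or>
    v^2 = 1 \<and> u^2 = - l - 1"
  unfolding bitangent_span_iff[of "klein_form l", OF klein_form_binary_quartic d] restr klein_form_chart
    quartic_eq_square_iff
  by (rule klein_restriction_square_iff[OF l])

text \<open>Homogeneous equations between squares, hence insensitive to scaling and to signs. For
  nonzero \<open>w\<close> each of the first six alternatives describes two lines and each of the
  last four describes four lines.\<close>

definition klein_bitangent_coords :: "complex \<Rightarrow> complex^3 \<Rightarrow> bool" where
  "klein_bitangent_coords \<alpha> w \<longleftrightarrow> (let c = \<alpha> - 1 in
     w$1 = 0 \<and> ((w$2)^2 = (\<alpha> * w$3)^2 \<or> (w$3)^2 = (\<alpha> * w$2)^2) \<or>
     w$2 = 0 \<and> ((w$1)^2 = (\<alpha> * w$3)^2 \<or> (w$3)^2 = (\<alpha> * w$1)^2) \<or>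
     w$3 = 0 \<and> ((w$1)^2 = (\<alpha> * w$2)^2 \<or> (w$2)^2 = (\<alpha> * w$1)^2) \<or>
     (w$2)^2 = (w$1)^2 \<and> (w$3)^2 = (w$1)^2 \<or>
     (w$2)^2 = (w$1)^2 \<and> (w$3)^2 = (c * w$1)^2 \<or>
     (w$3)^2 = (w$1)^2 \<and> (w$2)^2 = (c * w$1)^2 \<or>
     (w$3)^2 = (w$2)^2 \<and> (w$1)^2 = (c * w$2)^2)"

lemma klein_bitangent_iff_coords:
  assumes \<alpha>: "\<alpha>^2 + \<alpha> + 2 = 0" and w: "w \<noteq> 0"
  shows "bitangent (klein_form (3 * \<alpha>)) (proj_line_of w) \<longleftrightarrow> klein_bitangent_coords \<alpha> w"
proof -
  define l where "l = 3 * \<alpha>"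
  define c where "c = \<alpha> - 1"
  have l: "l \<noteq> 2" "l \<noteq> -2" "l \<noteq> -1" "l \<noteq> 1"
  proof -
    have "l^2 + 3 * l + 18 = 0" unfolding l_def using \<alpha> by algebra
    then show "l \<noteq> 2" "l \<noteq> -2" "l \<noteq> -1" "l \<noteq> 1" by auto
  qed
  have nz: "\<alpha> \<noteq> 0" "c \<noteq> 0" "l + 2 \<noteq> 0"
    using \<alpha> l by (auto simp: c_def simp flip: eq_neg_iff_add_eq_0)
  \<comment> \<open>The quartic in \<open>z\<close> splits for \<open>l = 3 \<alpha>\<close>; its
    leading coefficient is \<open>l + 2 = \<alpha>^4\<close>.\<close>
  have "(l + 2) * (z^4 + 1) + 2 * l * z^2 = \<alpha>^2 * ((z^2 - \<alpha>^2) * (\<alpha>^2 * z^2 - 1))" for z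
    unfolding l_def using \<alpha> by algebra
  then have Q: "(l + 2) * (z^4 + 1) + 2 * l * z^2 = 0 \<longleftrightarrow> z^2 = \<alpha>^2 \<or> \<alpha>^2 * z^2 = 1" for z
    using nz by simp
  \<comment> \<open>The origin of \<open>\<alpha> - 1\<close>: it is a square root of the constant
    in the other solutions.\<close>
  have c: "- l - 1 = c^2" unfolding l_def c_def using \<alpha> by algebra
  have U: "(l + 1) * z = -1 \<longleftrightarrow> c^2 * z = 1" for z
    unfolding c[symmetric] by algebra
  note chart = klein_bitangent_chart_iff[OF l, unfolded Q U c]
  consider "w$3 \<noteq> 0" | "w$3 = 0" "w$2 \<noteq> 0" | "w$3 = 0" "w$2 = 0" "w$1 \<noteq> 0"
    using w by (auto simp: vec3_eq_iff)
  then have "bitangent (klein_form l) (proj_line_of w) \<longleftrightarrow> klein_bitangent_coords \<alpha> w"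
  proof cases
    case 1
    define u v where "u = - w$1 / w$3" and "v = - w$2 / w$3"
    have w12: "w$1 = - u * w$3" "w$2 = - v * w$3" using 1 by (simp_all add: u_def v_def)
    have "bitangent (klein_form l) (proj_line_of w) \<longleftrightarrow>
       u = 0 \<and> (v^2 = \<alpha>^2 \<or> \<alpha>^2 * v^2 = 1) \<or> v = 0 \<and> (u^2 = \<alpha>^2 \<or> \<alpha>^2 * u^2 = 1) \<or>
       u^2 = 1 \<and> v^2 = 1 \<or> u^2 = v^2 \<and> c^2 * u^2 = 1 \<or> u^2 = 1 \<and> v^2 = c^2 \<or> v^2 = 1 \<and> u^2 = c^2"
      unfolding proj_line_of_eq_span(1)[OF 1] u_def[symmetric] v_def[symmetric]
    proof (rule chart[OF dim_chart(1)])
      fix s t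
      have "s *s vector [1, 0, u] + t *s vector [0, 1, v] = (vector [s, t, u * s + v * t] :: complex^3)"
        by (simp add: vec3_eq_iff)
      then show "klein_form l (s *s vector [1, 0, u] + t *s vector [0, 1, v]) =
          klein_form l (vector [s, t, u * s + v * t])" by simp
    qed
    also have "\<dots> \<longleftrightarrow> klein_bitangent_coords \<alpha> w"
      unfolding klein_bitangent_coords_def Let_def c_def[symmetric] w12 using 1
      by (auto simp: power_mult_distrib)
    finally show ?thesis .
  next
    case 2
    define u where "u = - w$1 / w$2"
    have w1: "w$1 = - u * w$2" using 2 by (simp add: u_def)
    have "bitangent (klein_form l) (proj_line_of w) \<longleftrightarrow>
       u = 0 \<and> (0^2 = \<alpha>^2 \<or> \<alpha>^2 * 0^2 = 1) \<or> 0 = (0::complex) \<and> (u^2 = \<alpha>^2 \<or> \<alpha>^2 * u^2 = 1) \<or>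
       u^2 = 1 \<and> 0^2 = (1::complex) \<or> u^2 = 0^2 \<and> c^2 * u^2 = 1 \<or> u^2 = 1 \<and> 0^2 = c^2 \<or> 0^2 = (1::complex) \<and> u^2 = c^2"
      unfolding proj_line_of_eq_span(2)[OF 2] u_def[symmetric]
    proof (rule chart[OF dim_chart(2)])
      fix s t
      have "s *s vector [1, u, 0] + t *s vector [0, 0, 1] = (vector [s, u * s, t] :: complex^3)"
        by (simp add: vec3_eq_iff)
      then show "klein_form l (s *s vector [1, u, 0] + t *s vector [0, 0, 1]) =
          klein_form l (vector [s, t, u * s + 0 * t])" by (simp add: klein_form_def algebra_simps)
    qed
    also have "\<dots> \<longleftrightarrow> klein_bitangent_coords \<alpha> w"
      unfolding klein_bitangent_coords_def Let_def c_def[symmetric] w1 using 2 nz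
      by (auto simp: power_mult_distrib)
    finally show ?thesis .
  next
    case 3
    \<comment> \<open>The line is \<open>x = 0\<close>, which is no bitangent: every alternative
      fails on both sides.\<close>
    have "bitangent (klein_form l) (proj_line_of w) \<longleftrightarrow>
       0 = (0::complex) \<and> (0^2 = \<alpha>^2 \<or> \<alpha>^2 * 0^2 = 1) \<or> 0 = (0::complex) \<and> (0^2 = \<alpha>^2 \<or> \<alpha>^2 * 0^2 = 1) \<or>
       0^2 = (1::complex) \<and> 0^2 = (1::complex) \<or> 0^2 = (0::complex)^2 \<and> c^2 * 0^2 = 1 \<or>
       0^2 = (1::complex) \<and> 0^2 = c^2 \<or> 0^2 = (1::complex) \<and> 0^2 = c^2"
      unfolding proj_line_of_eq_span(3)[OF 3]
    proof (rule chart[OF dim_chart(3)])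
      fix s t
      have "s *s vector [0, 1, 0] + t *s vector [0, 0, 1] = (vector [0, s, t] :: complex^3)"
        by (simp add: vec3_eq_iff)
      then show "klein_form l (s *s vector [0, 1, 0] + t *s vector [0, 0, 1]) =
          klein_form l (vector [s, t, 0 * s + 0 * t])" by (simp add: klein_form_def algebra_simps)
    qed
    also have "\<dots> \<longleftrightarrow> klein_bitangent_coords \<alpha> w"
      unfolding klein_bitangent_coords_def Let_def c_def[symmetric] using 3 nz
      by (auto simp: power_mult_distrib)
    finally show ?thesis .
  qed
  then show ?thesis unfolding l_def .
qed

section \<open>The arrangement over the integers\<close>

text \<open>The pair \<open>(a, b)\<close> stands for \<open>a + b \<alpha>\<close>, where \<open>\<alpha>\<^sup>2 = - \<alpha> - 2\<close>.\<close>

fun zadd :: "int \<times> int \<Rightarrow> int \<times> int \<Rightarrow> int \<times> int" where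
  "zadd (a, b) (c, d) = (a + c, b + d)"

fun zdiff :: "int \<times> int \<Rightarrow> int \<times> int \<Rightarrow> int \<times> int" where
  "zdiff (a, b) (c, d) = (a - c, b - d)"

fun zmult :: "int \<times> int \<Rightarrow> int \<times> int \<Rightarrow> int \<times> int" where
  "zmult (a, b) (c, d) = (a * c - 2 * b * d, a * d + b * c - b * d)"

type_synonym zvec = "(int \<times> int) \<times> (int \<times> int) \<times> (int \<times> int)"

fun zdot :: "zvec \<Rightarrow> zvec \<Rightarrow> int \<times> int" where
  "zdot (a, b, c) (d, e, f) = zadd (zadd (zmult a d) (zmult b e)) (zmult c f)"

fun zcross :: "zvec \<Rightarrow> zvec \<Rightarrow> zvec" where
  "zcross (a, b, c) (d, e, f) = (zdiff (zmult b f) (zmult c e),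
     zdiff (zmult c d) (zmult a f), zdiff (zmult a e) (zmult b d))"

text \<open>One representative per line, with some coordinate equal to 1; \<open>(- t, t)\<close> is
  \<open>t * (\<alpha> - 1)\<close>.\<close>

definition klein_lines :: "zvec list" where
  "klein_lines =
    [((1, 0), (s, 0), (t, 0)). s \<leftarrow> [1, -1], t \<leftarrow> [1, -1]] @
    concat [[((0, 0), (1, 0), (0, s)), ((0, 0), (0, s), (1, 0)), ((1, 0), (0, 0), (0, s)),
             ((0, s), (0, 0), (1, 0)), ((1, 0), (0, s), (0, 0)), ((0, s), (1, 0), (0, 0))]. s \<leftarrow> [1, -1]] @
    concat [[((1, 0), (s, 0), (- t, t)), ((1, 0), (- t, t), (s, 0)), ((- t, t), (1, 0), (s, 0))].
            s \<leftarrow> [1, -1], t \<leftarrow> [1, -1]]"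

text \<open>A sublist of a fixed list, so equal sets of lines are equal lists and can be compared by
  evaluation.\<close>

definition block :: "zvec \<Rightarrow> zvec list" where
  "block p = filter (\<lambda>w. zdot w p = (0, 0)) klein_lines"

text \<open>For distinct entries, each unordered pair occurs once, in list order. As
  \<open>block\<close> keeps that order too, a double point yields \<open>[v, w]\<close> and never
  \<open>[w, v]\<close>.\<close>

primrec pairs :: "'a list \<Rightarrow> ('a \<times> 'a) list" where
  "pairs [] = []"
| "pairs (x # xs) = map (Pair x) xs @ pairs xs"

lemma klein_lines_distinct: "distinct klein_lines"
  by code_simp

text \<open>Evaluation of all 378 pairs; it excludes triple points and multiplicities above
  4.\<close>

lemma block_cases:
  "list_all (\<lambda>(v, w). block (zcross v w) = [v, w] \<or> length (block (zcross v w)) = 4) (pairs klein_lines)"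
  by code_simp

text \<open>A double point comes from exactly one pair, so counting pairs counts points.\<close>

lemma double_count:
  "length (filter (\<lambda>(v, w). block (zcross v w) = [v, w]) (pairs klein_lines)) = 252"
  by code_simp

text \<open>Each quadruple point comes from all 6 pairs of its four lines, hence
  \<open>remdups\<close>.\<close>

lemma quadruple_count:
  "length (remdups (filter (\<lambda>b. length b = 4) (map (\<lambda>(v, w). block (zcross v w)) (pairs klein_lines)))) = 21"
  by code_simp

lemma set_pairs_subset: "(x, y) \<in> set (pairs xs) \<Longrightarrow> x \<in> set xs \<and> y \<in> set xs"
  by (induction xs) auto

lemma pairs_total: "x \<in> set xs \<Longrightarrow> y \<in> set xs \<Longrightarrow> x \<noteq> y \<Longrightarrow> (x, y) \<in> set (pairs xs) \<or> (y, x) \<in> set (pairs xs)"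
  by (induction xs) auto

lemma distinct_pairs: "distinct xs \<Longrightarrow> distinct (pairs xs)"
  by (induction xs) (auto simp: distinct_map inj_on_def dest: set_pairs_subset)

lemma pairs_distinct: "distinct xs \<Longrightarrow> (x, y) \<in> set (pairs xs) \<Longrightarrow> x \<noteq> y"
  by (induction xs) auto

section \<open>Evaluation of integer pairs in the complex numbers\<close>

definition zval :: "complex \<Rightarrow> int \<times> int \<Rightarrow> complex" where
  "zval \<alpha> x = of_int (fst x) + of_int (snd x) * \<alpha>"

definition zvec_val :: "complex \<Rightarrow> zvec \<Rightarrow> complex^3" where
  "zvec_val \<alpha> = (\<lambda>(x, y, z). vector [zval \<alpha> x, zval \<alpha> y, zval \<alpha> z])"

lemma zvec_val_nth [simp]:
  "zvec_val \<alpha> (x, y, z) $ 1 = zval \<alpha> x" "zvec_val \<alpha> (x, y, z) $ 2 = zval \<alpha> y"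
  "zvec_val \<alpha> (x, y, z) $ 3 = zval \<alpha> z"
  by (simp_all add: zvec_val_def)

context
  fixes \<alpha> :: complex
  assumes \<alpha>: "\<alpha>^2 + \<alpha> + 2 = 0"
begin

lemma zval_zadd: "zval \<alpha> (zadd x y) = zval \<alpha> x + zval \<alpha> y"
  by (cases x; cases y) (simp add: zval_def algebra_simps)

lemma zval_zdiff: "zval \<alpha> (zdiff x y) = zval \<alpha> x - zval \<alpha> y"
  by (cases x; cases y) (simp add: zval_def algebra_simps)

lemma zval_zmult: "zval \<alpha> (zmult x y) = zval \<alpha> x * zval \<alpha> y"
proof -
  obtain a b c d where "x = (a, b)" "y = (c, d)" by (cases x; cases y)
  moreover have "(of_int a * of_int c - 2 * of_int b * of_int d) +
      (of_int a * of_int d + of_int b * of_int c - of_int b * of_int d) * \<alpha> =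
      (of_int a + of_int b * \<alpha>) * (of_int c + of_int d * \<alpha>)"
    using \<alpha> by algebra
  ultimately show ?thesis by (simp add: zval_def)
qed

text \<open>Four times the norm of \<open>m + n \<alpha>\<close> is
  \<open>(2 m - n)^2 + 7 n^2\<close>, which is positive definite. Zero tests on pairs are therefore
  faithful, and incidences computed with integers are those over the complex numbers.\<close>

lemma zval_eq_0_iff: "zval \<alpha> x = 0 \<longleftrightarrow> x = (0, 0)"
proof
  assume *: "zval \<alpha> x = 0"
  obtain m n where x: "x = (m, n)" by (cases x)
  have "(of_int m :: complex) + of_int n * \<alpha> = 0" using * x by (simp add: zval_def)
  then have "(2 * of_int m - of_int n)^2 + 7 * (of_int n)^2 = (0 :: complex)" using \<alpha> by algebra
  then have "of_int ((2 * m - n)^2 + 7 * n^2) = (0 :: complex)" by simp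
  then have eq: "(2 * m - n)^2 + 7 * n^2 = 0" unfolding of_int_eq_0_iff .
  have "n = 0"
  proof (rule ccontr)
    assume "n \<noteq> 0"
    then have "0 < n^2" by simp
    then show False using eq zero_le_power2[of "2 * m - n"] by linarith
  qed
  then show "x = (0, 0)" using eq x by simp
qed (simp add: zval_def)

lemma zvec_val_eq_0_iff: "zvec_val \<alpha> p = 0 \<longleftrightarrow> p = ((0, 0), (0, 0), (0, 0))"
  by (cases p) (auto simp: vec3_eq_iff zval_eq_0_iff)

lemma zvec_val_zcross: "zvec_val \<alpha> (zcross v w) = cross (zvec_val \<alpha> v) (zvec_val \<alpha> w)"
  by (cases v rule: prod_cases3; cases w rule: prod_cases3)
    (simp add: cross_def vec3_eq_iff zval_zdiff zval_zmult del: zmult.simps zdiff.simps)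

lemma zvec_val_in_line_iff:
  "zvec_val \<alpha> p \<in> proj_line_of (zvec_val \<alpha> w) \<longleftrightarrow> zdot w p = (0, 0)"
  unfolding zval_eq_0_iff[symmetric]
  by (cases p rule: prod_cases3; cases w rule: prod_cases3)
    (simp add: proj_line_of_def zval_zadd zval_zmult del: zmult.simps zadd.simps)

end

section \<open>Common points of two lines\<close>

lemma proj_line_of_subset_iff:
  assumes "w \<noteq> 0" shows "vec.span {p} \<subseteq> proj_line_of w \<longleftrightarrow> p \<in> proj_line_of w"
  using proj_line_of_in_proj_lines[OF assms] span_singleton_subset_iff
  unfolding proj_lines_def by blast

text \<open>By the triple product expansion, \<open>cross r (cross v w)\<close> is a combination of
  \<open>v\<close> and \<open>w\<close> whose coefficients are, up to sign, the pairings of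
  \<open>r\<close> with \<open>w\<close> and \<open>v\<close>. Both vanish for \<open>r\<close> on
  both lines, so \<open>r\<close> is proportional to \<open>cross v w\<close>.\<close>

lemma point_on_two_lines_iff:
  assumes "v \<noteq> 0" "w \<noteq> 0" "cross v w \<noteq> 0" "P \<in> proj_points"
  shows "P \<subseteq> proj_line_of v \<and> P \<subseteq> proj_line_of w \<longleftrightarrow> P = vec.span {cross v w}"
proof -
  obtain r where r: "r \<noteq> 0" "P = vec.span {r}" using assms proj_points_iff by blast
  have "r \<in> proj_line_of v \<and> r \<in> proj_line_of w \<Longrightarrow> cross r (cross v w) = 0"
    unfolding proj_line_of_def cross_def vec3_eq_iff mem_Collect_eq vector_3 zero_index by algebra
  then have "r \<in> proj_line_of v \<and> r \<in> proj_line_of w \<Longrightarrow> P = vec.span {cross v w}"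
    using cross_eq_0_iff span_singleton_eq_iff[OF r(1) assms(3)] r by blast
  moreover have "cross v w \<in> proj_line_of v" "cross v w \<in> proj_line_of w"
    by (simp_all add: proj_line_of_def cross_def algebra_simps)
  ultimately show ?thesis using r assms(1,2) proj_line_of_subset_iff by metis
qed

text \<open>Were the cross product nonzero, every point of the common line would be
  \<open>vec.span {cross v w}\<close>, but a line has two distinct points.\<close>

lemma proj_line_of_eq_imp_cross:
  assumes "v \<noteq> 0" "w \<noteq> 0" "proj_line_of v = proj_line_of w"
  shows "cross v w = 0"
proof (rule ccontr)
  assume nz: "cross v w \<noteq> 0"
  obtain p q where pq: "vec.dim {p, q} = 2" "proj_line_of v = vec.span {p, q}"
    using proj_line_of_in_proj_lines[OF assms(1)] proj_lines_iff by blast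
  have nz': "p \<noteq> 0" "q \<noteq> 0" using dim_pair_nonzero[OF pq(1)] by simp_all
  then have "vec.span {p} \<in> proj_points" "vec.span {q} \<in> proj_points"
    using proj_points_iff by blast+
  moreover have "vec.span {p} \<subseteq> proj_line_of v" "vec.span {q} \<subseteq> proj_line_of v"
    unfolding pq(2) by (auto intro!: vec.span_mono)
  ultimately have "vec.span {p} = vec.span {q}"
    using point_on_two_lines_iff[OF assms(1,2) nz] assms(3) by simp
  then show False using span_singleton_eq_iff[OF nz'] pq by simp
qed

text \<open>Both signs range over every shape, even where only \<open>s\<close> occurs, so that one
  elimination covers all vectors.\<close>

lemma set_klein_lines:
  "set klein_lines =
    (\<Union>s\<in>{1, -1}. \<Union>t\<in>{1, -1}. {((1, 0), (s, 0), (t, 0)),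
       ((1, 0), (s, 0), (- t, t)), ((1, 0), (- t, t), (s, 0)), ((- t, t), (1, 0), (s, 0)),
       ((0, 0), (1, 0), (0, s)), ((0, 0), (0, s), (1, 0)), ((1, 0), (0, 0), (0, s)),
       ((0, s), (0, 0), (1, 0)), ((1, 0), (0, s), (0, 0)), ((0, s), (1, 0), (0, 0))})"
  unfolding klein_lines_def by auto

text \<open>The sign is an integer so that it can be an entry of a vector in
  \<open>klein_lines\<close>.\<close>

lemma power2_eq_imp_sign:
  fixes x y :: complex
  assumes "x^2 = y^2"
  obtains s :: int where "s \<in> {1, -1}" "x = of_int s * y"
proof -
  from assms consider "x = y" | "x = - y" using power2_eq_iff by blast
  then show thesis using that[of 1] that[of "-1"] by cases simp_all
qed

lemma klein_bitangent_coords_klein_lines: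
  assumes "v \<in> set klein_lines"
  shows "klein_bitangent_coords \<alpha> (zvec_val \<alpha> v)"
proof -
  obtain s t :: int where st: "s \<in> {1, -1}" "t \<in> {1, -1}"
    and v: "v \<in> {((1, 0), (s, 0), (t, 0)),
       ((1, 0), (s, 0), (- t, t)), ((1, 0), (- t, t), (s, 0)), ((- t, t), (1, 0), (s, 0)),
       ((0, 0), (1, 0), (0, s)), ((0, 0), (0, s), (1, 0)), ((1, 0), (0, 0), (0, s)),
       ((0, s), (0, 0), (1, 0)), ((1, 0), (0, s), (0, 0)), ((0, s), (1, 0), (0, 0))}"
    using assms unfolding set_klein_lines by (elim UN_E)
  have sq: "(of_int s)^2 = (1 :: complex)" "(of_int t)^2 = (1 :: complex)" using st by auto
  have c: "zval \<alpha> (- t, t) = of_int t * (\<alpha> - 1)" by (simp add: zval_def algebra_simps)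
  have z: "zval \<alpha> (1, 0) = 1" "zval \<alpha> (0, 0) = 0" "zval \<alpha> (s, 0) = of_int s"
    "zval \<alpha> (t, 0) = of_int t" "zval \<alpha> (0, s) = of_int s * \<alpha>" by (simp_all add: zval_def)
  from v show ?thesis
    unfolding klein_bitangent_coords_def Let_def
    by (elim insertE emptyE) (simp_all add: c z sq power_mult_distrib)
qed

text \<open>Extracting square roots leaves the signs that index the list; \<open>k\<close> is the
  coordinate of \<open>w\<close> at which the representative has the entry 1.\<close>

lemma klein_bitangent_coords_imp:
  assumes c: "klein_bitangent_coords \<alpha> w"
  obtains v k where "v \<in> set klein_lines" "w = k *s zvec_val \<alpha> v"
proof -
  have I: thesis
    if "(p, q, r) \<in> set klein_lines" "w$1 = k * zval \<alpha> p" "w$2 = k * zval \<alpha> q" "w$3 = k * zval \<alpha> r"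
    for p q r k
    using that(2-4) by (intro \<open>\<And>v k. v \<in> set klein_lines \<Longrightarrow> w = k *s zvec_val \<alpha> v \<Longrightarrow> thesis\<close>[OF that(1), of k])
      (simp add: vec3_eq_iff)
  show thesis
    using c unfolding klein_bitangent_coords_def Let_def
  proof (elim disjE conjE)
    assume h: "w$1 = 0" "(w$2)^2 = (\<alpha> * w$3)^2"
    from h(2) obtain s :: int where "s \<in> {1, -1}" "w$2 = of_int s * (\<alpha> * w$3)" by (rule power2_eq_imp_sign)
    then show thesis using h by (intro I[of "(0, 0)" "(0, s)" "(1, 0)" "w$3"]) (auto simp: set_klein_lines zval_def)
  next
    assume h: "w$1 = 0" "(w$3)^2 = (\<alpha> * w$2)^2"
    from h(2) obtain s :: int where "s \<in> {1, -1}" "w$3 = of_int s * (\<alpha> * w$2)" by (rule power2_eq_imp_sign)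
    then show thesis using h by (intro I[of "(0, 0)" "(1, 0)" "(0, s)" "w$2"]) (auto simp: set_klein_lines zval_def)
  next
    assume h: "w$2 = 0" "(w$1)^2 = (\<alpha> * w$3)^2"
    from h(2) obtain s :: int where "s \<in> {1, -1}" "w$1 = of_int s * (\<alpha> * w$3)" by (rule power2_eq_imp_sign)
    then show thesis using h by (intro I[of "(0, s)" "(0, 0)" "(1, 0)" "w$3"]) (auto simp: set_klein_lines zval_def)
  next
    assume h: "w$2 = 0" "(w$3)^2 = (\<alpha> * w$1)^2"
    from h(2) obtain s :: int where "s \<in> {1, -1}" "w$3 = of_int s * (\<alpha> * w$1)" by (rule power2_eq_imp_sign)
    then show thesis using h by (intro I[of "(1, 0)" "(0, 0)" "(0, s)" "w$1"]) (auto simp: set_klein_lines zval_def)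
  next
    assume h: "w$3 = 0" "(w$1)^2 = (\<alpha> * w$2)^2"
    from h(2) obtain s :: int where "s \<in> {1, -1}" "w$1 = of_int s * (\<alpha> * w$2)" by (rule power2_eq_imp_sign)
    then show thesis using h by (intro I[of "(0, s)" "(1, 0)" "(0, 0)" "w$2"]) (auto simp: set_klein_lines zval_def)
  next
    assume h: "w$3 = 0" "(w$2)^2 = (\<alpha> * w$1)^2"
    from h(2) obtain s :: int where "s \<in> {1, -1}" "w$2 = of_int s * (\<alpha> * w$1)" by (rule power2_eq_imp_sign)
    then show thesis using h by (intro I[of "(1, 0)" "(0, s)" "(0, 0)" "w$1"]) (auto simp: set_klein_lines zval_def)
  next
    assume h: "(w$2)^2 = (w$1)^2" "(w$3)^2 = (w$1)^2"
    from h(1) obtain s :: int where s: "s \<in> {1, -1}" "w$2 = of_int s * w$1" by (rule power2_eq_imp_sign)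
    from h(2) obtain t :: int where t: "t \<in> {1, -1}" "w$3 = of_int t * (w$1)" by (rule power2_eq_imp_sign)
    show thesis using s t by (intro I[of "(1, 0)" "(s, 0)" "(t, 0)" "w$1"]) (auto simp: set_klein_lines zval_def)
  next
    assume h: "(w$2)^2 = (w$1)^2" "(w$3)^2 = ((\<alpha> - 1) * w$1)^2"
    from h(1) obtain s :: int where s: "s \<in> {1, -1}" "w$2 = of_int s * w$1" by (rule power2_eq_imp_sign)
    from h(2) obtain t :: int where t: "t \<in> {1, -1}" "w$3 = of_int t * ((\<alpha> - 1) * w$1)" by (rule power2_eq_imp_sign)
    show thesis using s t by (intro I[of "(1, 0)" "(s, 0)" "(- t, t)" "w$1"]) (auto simp: set_klein_lines zval_def algebra_simps)
  next
    assume h: "(w$3)^2 = (w$1)^2" "(w$2)^2 = ((\<alpha> - 1) * w$1)^2"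
    from h(1) obtain s :: int where s: "s \<in> {1, -1}" "w$3 = of_int s * w$1" by (rule power2_eq_imp_sign)
    from h(2) obtain t :: int where t: "t \<in> {1, -1}" "w$2 = of_int t * ((\<alpha> - 1) * w$1)" by (rule power2_eq_imp_sign)
    show thesis using s t by (intro I[of "(1, 0)" "(- t, t)" "(s, 0)" "w$1"]) (auto simp: set_klein_lines zval_def algebra_simps)
  next
    assume h: "(w$3)^2 = (w$2)^2" "(w$1)^2 = ((\<alpha> - 1) * w$2)^2"
    from h(1) obtain s :: int where s: "s \<in> {1, -1}" "w$3 = of_int s * w$2" by (rule power2_eq_imp_sign)
    from h(2) obtain t :: int where t: "t \<in> {1, -1}" "w$1 = of_int t * ((\<alpha> - 1) * w$2)" by (rule power2_eq_imp_sign)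
    show thesis using s t by (intro I[of "(- t, t)" "(1, 0)" "(s, 0)" "w$2"]) (auto simp: set_klein_lines zval_def algebra_simps)
  qed
qed

lemma klein_lines_nonzero: "v \<in> set klein_lines \<Longrightarrow> v \<noteq> ((0, 0), (0, 0), (0, 0))"
  by (auto simp: klein_lines_def)

lemma klein_bitangents_eq:
  assumes \<alpha>: "\<alpha>^2 + \<alpha> + 2 = 0"
  shows "bitangents (klein_form (3 * \<alpha>)) = (\<lambda>v. proj_line_of (zvec_val \<alpha> v)) ` set klein_lines"
proof (intro equalityI subsetI)
  fix L assume "L \<in> bitangents (klein_form (3 * \<alpha>))"
  then have L: "bitangent (klein_form (3 * \<alpha>)) L" by (simp add: bitangents_def)
  then have "L \<in> proj_lines" by (simp add: bitangent_def)
  then obtain w where w: "w \<noteq> 0" "L = proj_line_of w" using proj_lines_obtain by blast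
  then have "klein_bitangent_coords \<alpha> w" using klein_bitangent_iff_coords[OF \<alpha>] L by blast
  then obtain v k where v: "v \<in> set klein_lines" "w = k *s zvec_val \<alpha> v"
    using klein_bitangent_coords_imp by blast
  then have "k \<noteq> 0" using w by auto
  then have "L = proj_line_of (zvec_val \<alpha> v)" using w v proj_line_of_scale by simp
  then show "L \<in> (\<lambda>v. proj_line_of (zvec_val \<alpha> v)) ` set klein_lines" using v by blast
next
  fix L assume "L \<in> (\<lambda>v. proj_line_of (zvec_val \<alpha> v)) ` set klein_lines"
  then obtain v where v: "v \<in> set klein_lines" "L = proj_line_of (zvec_val \<alpha> v)" by blast
  then have "zvec_val \<alpha> v \<noteq> 0" using zvec_val_eq_0_iff[OF \<alpha>] klein_lines_nonzero by blast
  then show "L \<in> bitangents (klein_form (3 * \<alpha>))"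
    using klein_bitangent_iff_coords[OF \<alpha>] klein_bitangent_coords_klein_lines v
    by (simp add: bitangents_def)
qed

text \<open>The zero vector lies on all 28 lines, whereas the block of a pair has length 2 or
  4.\<close>

lemma zcross_nonzero:
  assumes "(v, w) \<in> set (pairs klein_lines)"
  shows "zcross v w \<noteq> ((0, 0), (0, 0), (0, 0))"
proof
  assume *: "zcross v w = ((0, 0), (0, 0), (0, 0))"
  have "zdot u ((0, 0), (0, 0), (0, 0)) = (0, 0)" for u
    by (cases u rule: prod_cases3) auto
  then have "length (block (zcross v w)) = length klein_lines" by (simp add: * block_def)
  then have "length (block (zcross v w)) = 28" by (simp add: klein_lines_def)
  then show False using block_cases assms by (fastforce simp: list_all_iff)
qed

section \<open>Counting points through their blocks\<close>

theorem klein_arrangement: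
  assumes \<alpha>: "\<alpha>^2 + \<alpha> + 2 = 0"
  defines "\<A> \<equiv> bitangents (klein_form (3 * \<alpha>))"
  shows "card \<A> = 28" "card (arrangement_points \<A> 2) = 252" "card (arrangement_points \<A> 4) = 21"
    "intersection_points \<A> = arrangement_points \<A> 2 \<union> arrangement_points \<A> 4"
proof -
  define line where "line v = proj_line_of (zvec_val \<alpha> v)" for v
  define lines_through where "lines_through P = filter (\<lambda>v. P \<subseteq> line v) klein_lines" for P
  define blk where "blk = (\<lambda>(v, w). block (zcross v w))"
  define meet where "meet v w = vec.span {zvec_val \<alpha> (zcross v w)}" for v w
  have A: "\<A> = line ` set klein_lines"
    unfolding \<A>_def line_def by (rule klein_bitangents_eq[OF \<alpha>])
  have nz: "zvec_val \<alpha> v \<noteq> 0" if "v \<in> set klein_lines" for v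
    using that zvec_val_eq_0_iff[OF \<alpha>] klein_lines_nonzero by blast
  have cross_nz: "cross (zvec_val \<alpha> v) (zvec_val \<alpha> w) \<noteq> 0" if "(v, w) \<in> set (pairs klein_lines)" for v w
    using zcross_nonzero[OF that] zvec_val_eq_0_iff[OF \<alpha>] zvec_val_zcross[OF \<alpha>] by metis
  have inj: "inj_on line (set klein_lines)"
  proof (rule inj_onI, rule ccontr)
    fix v w assume vw: "v \<in> set klein_lines" "w \<in> set klein_lines" "line v = line w" "v \<noteq> w"
    then have eq: "proj_line_of (zvec_val \<alpha> v) = proj_line_of (zvec_val \<alpha> w)" by (simp add: line_def)
    have "cross (zvec_val \<alpha> v) (zvec_val \<alpha> w) = 0" "cross (zvec_val \<alpha> w) (zvec_val \<alpha> v) = 0"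
      using proj_line_of_eq_imp_cross[OF nz nz] eq vw(1,2) by simp_all
    then show False
      using pairs_total[OF vw(1,2,4)] cross_nz[of v w] cross_nz[of w v] by (elim disjE) simp_all
  qed
  show "card \<A> = 28"
    unfolding A card_image[OF inj] distinct_card[OF klein_lines_distinct] by (simp add: klein_lines_def)
  have through: "P \<subseteq> line v \<and> P \<subseteq> line w \<longleftrightarrow> P = meet v w"
    if "(v, w) \<in> set (pairs klein_lines)" "P \<in> proj_points" for v w P
  proof -
    have "v \<in> set klein_lines" "w \<in> set klein_lines" using set_pairs_subset[OF that(1)] by simp_all
    from point_on_two_lines_iff[OF nz[OF this(1)] nz[OF this(2)] cross_nz[OF that(1)] that(2)]
    show ?thesis unfolding line_def meet_def zvec_val_zcross[OF \<alpha>] .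
  qed
  have meet: "meet v w \<in> proj_points" "lines_through (meet v w) = blk (v, w)"
    if "(v, w) \<in> set (pairs klein_lines)" for v w
  proof -
    show "meet v w \<in> proj_points"
      unfolding proj_points_iff meet_def zvec_val_zcross[OF \<alpha>] using cross_nz[OF that] by blast
    have "meet v w \<subseteq> line u \<longleftrightarrow> zdot u (zcross v w) = (0, 0)" if "u \<in> set klein_lines" for u
      unfolding meet_def line_def proj_line_of_subset_iff[OF nz[OF that]] by (rule zvec_val_in_line_iff[OF \<alpha>])
    then show "lines_through (meet v w) = blk (v, w)"
      unfolding lines_through_def blk_def block_def prod.case by (rule filter_cong[OF refl])
  qed
  have card_through: "card {L \<in> \<A>. P \<subseteq> L} = length (lines_through P)" for P
  proof -
    have "{L \<in> \<A>. P \<subseteq> L} = line ` set (lines_through P)" by (auto simp: A lines_through_def)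
    moreover have "inj_on line (set (lines_through P))"
      by (rule inj_on_subset[OF inj]) (auto simp: lines_through_def)
    moreover have "distinct (lines_through P)" by (simp add: lines_through_def klein_lines_distinct)
    ultimately show ?thesis by (simp add: card_image distinct_card)
  qed
  have two: "\<exists>v w. (v, w) \<in> set (pairs klein_lines) \<and> v \<in> set (lines_through P) \<and> w \<in> set (lines_through P)"
    if "2 \<le> length (lines_through P)" for P
  proof -
    have "distinct (lines_through P)" by (simp add: lines_through_def klein_lines_distinct)
    moreover from that obtain v w vs where "lines_through P = v # w # vs"
      by (auto simp: Suc_le_length_iff numeral_2_eq_2)
    ultimately have vw: "v \<noteq> w" "v \<in> set (lines_through P)" "w \<in> set (lines_through P)" by simp_all
    then have "v \<in> set klein_lines" "w \<in> set klein_lines" by (simp_all add: lines_through_def)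
    from pairs_total[OF this vw(1)] show ?thesis using vw by (elim disjE) blast+
  qed
  have eq_meet: "P = meet v w"
    if "P \<in> proj_points" "(v, w) \<in> set (pairs klein_lines)" "v \<in> set (lines_through P)" "w \<in> set (lines_through P)"
    for P v w
    using through[OF that(2,1)] that(3,4) by (simp add: lines_through_def)
  have points: "arrangement_points \<A> k = {P \<in> proj_points. length (lines_through P) = k}" for k
    by (simp add: arrangement_points_def card_through)
  \<comment> \<open>The map \<open>lines_through\<close> is a bijection from the points on exactly
    \<open>k\<close> lines onto the blocks of length \<open>k\<close>; it is injective because
    \<open>2 \<le> k\<close> lines determine their common point.\<close>
  have card_points: "card (arrangement_points \<A> k) = card {b \<in> blk ` set (pairs klein_lines). length b = k}"
    if "2 \<le> k" for k
  proof (rule bij_betw_same_card[of lines_through], rule bij_betw_imageI)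
    show "inj_on lines_through (arrangement_points \<A> k)"
    proof (rule inj_onI)
      fix P Q assume "P \<in> arrangement_points \<A> k" "Q \<in> arrangement_points \<A> k"
        and eq: "lines_through P = lines_through Q"
      then have PQ: "P \<in> proj_points" "Q \<in> proj_points" "2 \<le> length (lines_through P)"
        using that by (simp_all add: points)
      from two[OF PQ(3)] obtain v w where vw: "(v, w) \<in> set (pairs klein_lines)"
        "v \<in> set (lines_through P)" "w \<in> set (lines_through P)" by (elim exE conjE)
      show "P = Q" using eq_meet[OF PQ(1) vw] eq_meet[OF PQ(2) vw(1)] vw(2,3) eq by simp
    qed
    show "lines_through ` arrangement_points \<A> k = {b \<in> blk ` set (pairs klein_lines). length b = k}"
    proof (intro equalityI subsetI)
      fix b assume "b \<in> lines_through ` arrangement_points \<A> k"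
      then obtain P where P: "P \<in> proj_points" "length (lines_through P) = k" "b = lines_through P"
        by (auto simp: points)
      then have "2 \<le> length (lines_through P)" using \<open>2 \<le> k\<close> by simp
      from two[OF this] obtain v w where vw: "(v, w) \<in> set (pairs klein_lines)"
        "v \<in> set (lines_through P)" "w \<in> set (lines_through P)" by (elim exE conjE)
      then have "b = blk (v, w)" using eq_meet[OF P(1) vw] meet(2)[OF vw(1)] P(3) by simp
      then show "b \<in> {b \<in> blk ` set (pairs klein_lines). length b = k}"
        using imageI[OF vw(1), of blk] P(2,3) by simp
    next
      fix b assume "b \<in> {b \<in> blk ` set (pairs klein_lines). length b = k}"
      then obtain v w where "(v, w) \<in> set (pairs klein_lines)" "b = blk (v, w)" "length b = k" by auto
      then have "b = lines_through (meet v w)" "meet v w \<in> arrangement_points \<A> k"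
        using meet by (simp_all add: points)
      then show "b \<in> lines_through ` arrangement_points \<A> k" by blast
    qed
  qed
  have blk_cases: "blk (v, w) = [v, w] \<or> length (blk (v, w)) = 4" if "(v, w) \<in> set (pairs klein_lines)" for v w
    using block_cases that by (auto simp: list_all_iff blk_def)
  \<comment> \<open>A block of length 2 is the very pair that produced it, so these blocks
    correspond one to one to the pairs counted by \<open>double_count\<close>.\<close>
  have "{b \<in> blk ` set (pairs klein_lines). length b = 2} =
      (\<lambda>(v, w). [v, w]) ` set (filter (\<lambda>(v, w). block (zcross v w) = [v, w]) (pairs klein_lines))" (is "?l = ?r")
  proof (intro equalityI subsetI)
    fix b assume "b \<in> ?l"
    then obtain v w where vw: "(v, w) \<in> set (pairs klein_lines)" "b = blk (v, w)" "length b = 2" by auto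
    then have "blk (v, w) = [v, w]" using blk_cases[OF vw(1)] by auto
    then show "b \<in> ?r" using vw by (force simp: blk_def)
  next
    fix b assume "b \<in> ?r"
    then show "b \<in> ?l" by (force simp: blk_def)
  qed
  then have "card {b \<in> blk ` set (pairs klein_lines). length b = 2} =
      card (set (filter (\<lambda>(v, w). block (zcross v w) = [v, w]) (pairs klein_lines)))"
    by (simp add: card_image inj_on_def split_def prod_eq_iff)
  also have "\<dots> = 252"
    using distinct_card[OF distinct_filter[OF distinct_pairs[OF klein_lines_distinct]]] double_count by simp
  finally show "card (arrangement_points \<A> 2) = 252" using card_points[of 2] by simp
  have "{b \<in> blk ` set (pairs klein_lines). length b = 4} =
      set (filter (\<lambda>b. length b = 4) (map (\<lambda>(v, w). block (zcross v w)) (pairs klein_lines)))"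
    by (auto simp: blk_def)
  then have "card {b \<in> blk ` set (pairs klein_lines). length b = 4} = 21"
    using quadruple_count by (simp only: length_remdups_card_conv)
  then show "card (arrangement_points \<A> 4) = 21" using card_points[of 4] by simp
  show "intersection_points \<A> = arrangement_points \<A> 2 \<union> arrangement_points \<A> 4"
  proof (intro equalityI subsetI)
    fix P assume "P \<in> intersection_points \<A>"
    then have "P \<in> proj_points \<and> (\<exists>v\<in>set klein_lines. \<exists>w\<in>set klein_lines.
        line v \<noteq> line w \<and> P \<subseteq> line v \<and> P \<subseteq> line w)"
      unfolding intersection_points_def A by simp
    then obtain v w where P: "P \<in> proj_points" and vw: "v \<in> set klein_lines" "w \<in> set klein_lines"
      "line v \<noteq> line w" "P \<subseteq> line v" "P \<subseteq> line w"
      by (elim conjE bexE)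
    then have "v \<noteq> w" by blast
    \<comment> \<open>Only one order of \<open>v\<close> and \<open>w\<close> occurs in
      \<open>pairs klein_lines\<close>, so both are considered.\<close>
    from pairs_total[OF vw(1,2) this]
    obtain v' w' where vw': "(v', w') \<in> set (pairs klein_lines)" "P = meet v' w'"
      using through[OF _ P, of v w] through[OF _ P, of w v] vw(4,5) by blast
    then have "length (lines_through P) = 2 \<or> length (lines_through P) = 4"
      using blk_cases[OF vw'(1)] meet(2)[OF vw'(1)] by auto
    then show "P \<in> arrangement_points \<A> 2 \<union> arrangement_points \<A> 4" using P by (simp add: points)
  next
    fix P assume "P \<in> arrangement_points \<A> 2 \<union> arrangement_points \<A> 4"
    then have P: "P \<in> proj_points" "2 \<le> length (lines_through P)" by (auto simp: points)
    then obtain v w where vw: "(v, w) \<in> set (pairs klein_lines)"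
      "v \<in> set (lines_through P)" "w \<in> set (lines_through P)" using two[OF P(2)] by (elim exE conjE)
    then have on: "v \<in> set klein_lines" "w \<in> set klein_lines" "P \<subseteq> line v" "P \<subseteq> line w"
      by (simp_all add: lines_through_def)
    have "v \<noteq> w" using pairs_distinct[OF klein_lines_distinct vw(1)] .
    then have "line v \<noteq> line w" using inj_on_eq_iff[OF inj on(1,2)] by simp
    then show "P \<in> intersection_points \<A>"
      unfolding intersection_points_def A using P(1) on by blast
  qed
qed

theorem proposition3p1:
  fixes l :: complex
  assumes "l^2 + 3 * l + 18 = 0"
  shows "card (bitangents (klein_form l)) = 28 \<and>
    card (arrangement_points (bitangents (klein_form l)) 2) = 252 \<and>
    card (arrangement_points (bitangents (klein_form l)) 4) = 21 \<and>
    intersection_points (bitangents (klein_form l)) =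
      arrangement_points (bitangents (klein_form l)) 2 \<union>
      arrangement_points (bitangents (klein_form l)) 4"
proof -
  have "l = 3 * (l / 3)" by simp
  \<comment> \<open>The equation for \<open>l\<close>, divided by 9.\<close>
  moreover have "(l / 3)^2 + l / 3 + 2 = 0"
    using assms by (simp add: power_divide field_simps)
  ultimately show ?thesis using klein_arrangement[of "l / 3"] by simp
qed

end
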